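(* Let $G$ be a connected unicyclic (finite simple) graph, with edge ideal $I(G)$. Then $I(G)$ is bridge-friendly if and only if either (1) the unique cycle of $G$ is a $C_3$ or a $C_5$, and at least one vertex of this cycle has degree $2$ in $G$; or (2) the unique cycle of $G$ is a $C_6$, and two opposite vertices of this cycle have degree $2$ in $G$.
   Context: A graph is *unicyclic* if it contains exactly one cycle; $C_n$ denotes the cycle on $n$ vertices. Two vertices of a $C_6$ are opposite if they are at distance $3$ along the cycle. For a finite simple graph $G$ with vertex set $\{x_1,\dots,x_d\}$ and a field $\Bbbk$, the *edge ideal* is $I(G)=(x_ix_j : \{x_i,x_j\}\in E(G))\subseteq S=\Bbbk[x_1,\dots,x_d]$. **Bridge-friendliness.** Let $I\subseteq S$ be a monomial ideal with finite set of minimal monomial generators $\mathrm{MinGens}(I)$, and fix a total order $\succ$ on $\mathrm{MinGens}(I)$. If $m\succ m'$ we say $m$ *dominates* $m'$. Let $\sigma\subseteq\mathrm{MinGens}(I)$, and let $\mathrm{lcm}(\sigma)$ denote the least common multiple of its elements. - $m\in\sigma$ is a *bridge* of $\sigma$ if $\mathrm{lcm}(\sigma\setminus\{m\})=\mathrm{lcm}(\sigma)$. If $\sigma$ has a bridge, $\mathrm{sb}(\sigma)$ denotes its smallest bridge with respect to $\succ$. - $m\in\mathrm{MinGens}(I)\setminus\sigma$ is a *gap* of $\sigma$ if $\mathrm{lcm}(\sigma\cup\{m\})=\mathrm{lcm}(\sigma)$. - $m$ is a *true gap* of $\sigma$ if it is a gap of $\sigma$ and every bridge $m'$ of $\sigma\cup\{m\}$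 with $m\succ m'$ is a bridge of $\sigma$. - $\sigma$ is *potentially-type-2* if it has a bridge not dominating any of its true gaps. - $\sigma$ is *type-2* if it is potentially-type-2 and whenever there is another potentially-type-2 subset $\sigma'\ne\sigma$ with $\sigma'\setminus\{\mathrm{sb}(\sigma')\}=\sigma\setminus\{\mathrm{sb}(\sigma)\}$, we have $\mathrm{sb}(\sigma')\succ\mathrm{sb}(\sigma)$. The ideal $I$ is *bridge-friendly* if there exists a total order $\succ$ on $\mathrm{MinGens}(I)$ such that all potentially-type-2 subsets of $\mathrm{MinGens}(I)$ are type-2. *)

theory Defs
  imports Complex_Main "HOL-Library.Poly_Mapping"
begin

section \<open>Graphs\<close>

text \<open>A finite simple graph is given by its edge set; the vertex set is the whole finite type
  \<open>'v\<close>, so that the polynomials over \<open>'v\<close> below form exactly the ring with one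
  variable per vertex.\<close>

definition simple_graph :: "'v::finite set set \<Rightarrow> bool" where
  "simple_graph E \<longleftrightarrow> (\<forall>e\<in>E. card e = 2)"

definition connected_graph :: "'v::finite set set \<Rightarrow> bool" where
  "connected_graph E \<longleftrightarrow> (\<forall>u v. (u, v) \<in> {(x, y). {x, y} \<in> E}\<^sup>*)"

definition degree :: "'v::finite set set \<Rightarrow> 'v \<Rightarrow> nat" where
  "degree E v = card {e \<in> E. v \<in> e}"

text \<open>A cycle is presented by the list of its vertices in cyclic order. The presentation is unique
  only up to rotation and reflection; as a subgraph the cycle is determined by its edge set.\<close>

definition cycle_edges :: "'v::finite list \<Rightarrow> 'v set set" where
  "cycle_edges p = {{p ! i, p ! (Suc i mod length p)} | i. i < length p}"

definition is_cycle :: "'v::finite set set \<Rightarrow> 'v list \<Rightarrow> bool" where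
  "is_cycle E p \<longleftrightarrow> 3 \<le> length p \<and> distinct p \<and> cycle_edges p \<subseteq> E"

definition unicyclic :: "'v::finite set set \<Rightarrow> bool" where
  "unicyclic E \<longleftrightarrow> (\<exists>!C. \<exists>p. is_cycle E p \<and> C = cycle_edges p)"

definition opposite :: "'v::finite list \<Rightarrow> 'v \<Rightarrow> 'v \<Rightarrow> bool" where
  "opposite p u v \<longleftrightarrow> length p = 6 \<and> (\<exists>i<6. u = p ! i \<and> v = p ! ((i + 3) mod 6))"

section \<open>Monomials and monomial ideals\<close>

text \<open>A monomial is its exponent vector, so the product of monomials is \<open>+\<close> and the
  monomial \<open>1\<close> is \<open>0\<close>. Polynomials are finitely supported maps from monomials to
  coefficients, with the convolution product of \<^theory>\<open>HOL-Library.Poly_Mapping\<close>.\<close>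

type_synonym 'v monomial = "'v \<Rightarrow>\<^sub>0 nat"
type_synonym ('v, 'k) polynomial = "'v monomial \<Rightarrow>\<^sub>0 'k"

definition monom :: "'v monomial \<Rightarrow> ('v, 'k::field) polynomial" where
  "monom m = Poly_Mapping.single m 1"

definition var :: "'v \<Rightarrow> 'v monomial" where
  "var v = Poly_Mapping.single v 1"

definition ideal_generated :: "('v, 'k::field) polynomial set \<Rightarrow> ('v, 'k) polynomial set" where
  "ideal_generated B = module.span (*) B"

definition edge_ideal :: "'v::finite set set \<Rightarrow> ('v, 'k::field) polynomial set" where
  "edge_ideal E = ideal_generated {monom (var u + var v) | u v. {u, v} \<in> E}"

definition mdvd :: "'v monomial \<Rightarrow> 'v monomial \<Rightarrow> bool" where
  "mdvd m m' \<longleftrightarrow> (\<forall>v. Poly_Mapping.lookup m v \<le> Poly_Mapping.lookup m' v)"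

text \<open>The minimal monomial generators of a monomial ideal are the monomials in it that are minimal
  with respect to divisibility.\<close>

definition min_gens :: "('v::finite, 'k::field) polynomial set \<Rightarrow> 'v monomial set" where
  "min_gens I = {m. monom m \<in> I \<and> (\<forall>m'. monom m' \<in> I \<and> mdvd m' m \<longrightarrow> m' = m)}"

text \<open>The inserted \<open>0\<close> gives the empty set the least common multiple \<open>1\<close>.\<close>

definition mlcm :: "'v::finite monomial set \<Rightarrow> 'v monomial" where
  "mlcm \<sigma> = Abs_poly_mapping (\<lambda>v. Max (insert 0 ((\<lambda>m. Poly_Mapping.lookup m v) ` \<sigma>)))"

lemma lookup_mlcm:
  "Poly_Mapping.lookup (mlcm \<sigma>) v =
    Max (insert 0 ((\<lambda>m. Poly_Mapping.lookup m v) ` \<sigma>))"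
  by (simp add: mlcm_def)

section \<open>Bridge-friendliness\<close>

text \<open>Throughout, \<open>A\<close> is the set of minimal generators and \<open>r\<close> a total order on it
  in the sense of \<^const>\<open>linear_order_on\<close>: a pair \<open>(a, b) \<in> r\<close> means that
  \<open>b\<close> dominates or equals \<open>a\<close>.\<close>

definition dominates :: "'a rel \<Rightarrow> 'a \<Rightarrow> 'a \<Rightarrow> bool" where
  "dominates r m m' \<longleftrightarrow> (m', m) \<in> r \<and> m \<noteq> m'"

definition bridge :: "'v::finite monomial set \<Rightarrow> 'v monomial \<Rightarrow> bool" where
  "bridge \<sigma> m \<longleftrightarrow> m \<in> \<sigma> \<and> mlcm (\<sigma> - {m}) = mlcm \<sigma>"

definition smallest_bridge :: "'v::finite monomial rel \<Rightarrow> 'v monomial set \<Rightarrow> 'v monomial" where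
  "smallest_bridge r \<sigma> = (THE m. bridge \<sigma> m \<and> (\<forall>m'. bridge \<sigma> m' \<longrightarrow> (m, m') \<in> r))"

definition gap :: "'v::finite monomial set \<Rightarrow> 'v monomial set \<Rightarrow> 'v monomial \<Rightarrow> bool" where
  "gap A \<sigma> m \<longleftrightarrow> m \<in> A - \<sigma> \<and> mlcm (\<sigma> \<union> {m}) = mlcm \<sigma>"

definition true_gap ::
  "'v::finite monomial set \<Rightarrow> 'v monomial rel \<Rightarrow> 'v monomial set \<Rightarrow> 'v monomial \<Rightarrow> bool" where
  "true_gap A r \<sigma> m \<longleftrightarrow> gap A \<sigma> m \<and>
     (\<forall>m'. bridge (\<sigma> \<union> {m}) m' \<and> dominates r m m' \<longrightarrow> bridge \<sigma> m')"

definition potentially_type2 ::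
  "'v::finite monomial set \<Rightarrow> 'v monomial rel \<Rightarrow> 'v monomial set \<Rightarrow> bool" where
  "potentially_type2 A r \<sigma> \<longleftrightarrow>
     (\<exists>m. bridge \<sigma> m \<and> (\<forall>g. true_gap A r \<sigma> g \<longrightarrow> \<not> dominates r m g))"

definition type2 ::
  "'v::finite monomial set \<Rightarrow> 'v monomial rel \<Rightarrow> 'v monomial set \<Rightarrow> bool" where
  "type2 A r \<sigma> \<longleftrightarrow> potentially_type2 A r \<sigma> \<and>
     (\<forall>\<sigma>'. \<sigma>' \<subseteq> A \<and> \<sigma>' \<noteq> \<sigma> \<and> potentially_type2 A r \<sigma>' \<and>
        \<sigma>' - {smallest_bridge r \<sigma>'} = \<sigma> - {smallest_bridge r \<sigma>} \<longrightarrow>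
        dominates r (smallest_bridge r \<sigma>') (smallest_bridge r \<sigma>))"

definition bridge_friendly :: "('v::finite, 'k::field) polynomial set \<Rightarrow> bool" where
  "bridge_friendly I \<longleftrightarrow> (\<exists>r. linear_order_on (min_gens I) r \<and>
     (\<forall>\<sigma> \<subseteq> min_gens I. potentially_type2 (min_gens I) r \<sigma> \<longrightarrow> type2 (min_gens I) r \<sigma>))"

end

theory Submission
  imports Defs
begin

text \<open>All generators of an edge ideal are squarefree, so the least common multiple of a set of them
  records just which vertices its edges cover. Bridges and gaps thereby become notions about
  families of edges: an edge of \<open>\<sigma>\<close> is a bridge if the other edges of \<open>\<sigma>\<close> still
  cover both its endpoints, an edge outside \<open>\<sigma>\<close> is a gap if \<open>\<sigma>\<close> covers both its
  endpoints. A total order is encoded by an injective weight \<open>g\<close> on the edges, heavier edges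
  dominating lighter ones.

  If two potentially-type-2 sets leave the same rest \<open>\<tau>\<close> after removal of their smallest
  bridges \<open>a\<close> and \<open>b\<close>, each of them being type-2 would make \<open>a\<close> lighter than
  \<open>b\<close> and \<open>b\<close> lighter than \<open>a\<close>. So an order is good exactly if there is no such
  pair, called a conflict below (\<open>bridge_friendly_edge_ideal_iff\<close>). Say \<open>b\<close> is the lighter
  one. It is a gap of \<open>\<tau> \<union> {a}\<close> and, since the bridge \<open>a\<close> must not dominate a true
  gap, not a true one. Hence adding \<open>b\<close> creates a new bridge \<open>c\<close> lighter than
  \<open>b\<close>. Then one endpoint of \<open>c\<close> is covered only thanks to \<open>a\<close> and the other one only
  thanks to \<open>b\<close>: the edges \<open>a\<close>, \<open>c\<close>, \<open>b\<close> form a path or a triangle whose middle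
  edge is the lightest (\<open>conflict_middle_edge\<close>), \<open>\<tau>\<close> contains no other edge at the
  endpoints of \<open>c\<close>, and \<open>\<tau>\<close> covers the far ends of \<open>a\<close> and \<open>b\<close>.

  Removing an edge outside the cycle of a connected unicyclic graph disconnects it, so these edges
  can be ordered from the outside inwards; every one of them then has an endpoint at which all
  other edges are lighter (\<open>hanging_decreases\<close>). If moreover all of them are lighter than the
  cycle edges, the three edges of a conflict are consecutive edges of the cycle
  (\<open>conflict_within_cycle\<close>).

  Conversely, for an arbitrary order let \<open>c = {x, y}\<close> be the lightest cycle edge and let
  \<open>z\<close> and \<open>w\<close> be the cycle vertices preceding \<open>x\<close> and following \<open>y\<close>. If
  \<open>z\<close> and \<open>w\<close> lie on edges \<open>f\<close> and \<open>h\<close>, equal or disjoint, that avoid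
  \<open>x\<close> and \<open>y\<close>, and if the vertices involved span no further edge, then
  \<open>{c, f, h}\<close> is the rest of a conflict (\<open>conflict_of_local_minimum\<close>). On a cycle of
  length \<open>4\<close> or at least \<open>7\<close> the edges \<open>f\<close> and \<open>h\<close> can be taken from the cycle.
  On a triangle \<open>z = w\<close> needs an edge leaving the cycle; on a pentagon both \<open>z\<close> and
  \<open>w\<close> do, because their next cycle edges meet; on a hexagon one of the opposite vertices
  \<open>z\<close> and \<open>w\<close> does, because their next cycle edges are joined by an edge.
  Outside the graphs listed in the theorem such edges are therefore available whichever cycle edge
  is the lightest. For the listed graphs, vertices of degree \<open>2\<close> leave so few edges for
  covering \<open>z\<close> and \<open>w\<close> that a suitable order of the cycle edges admits no conflict: one of
  \<open>z\<close> and \<open>w\<close> cannot be covered, or there is a bridge lighter than \<open>a\<close> or \<open>b\<close>, or a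
  true gap lighter than one of them.\<close>

section \<open>Bridges and gaps of sets of edges\<close>

definition edge_monom :: "'v::finite set \<Rightarrow> 'v monomial" where
  "edge_monom e = (\<Sum>v\<in>e. var v)"

lemma lookup_edge_monom: "Poly_Mapping.lookup (edge_monom e) w = (if w \<in> e then 1 else 0)"
proof -
  have "Poly_Mapping.lookup (edge_monom e) w = (\<Sum>v\<in>e. if v = w then 1 else 0)"
    by (simp add: edge_monom_def var_def lookup_sum lookup_single when_def)
  then show ?thesis by simp
qed

lemma inj_edge_monom: "inj (edge_monom :: 'v::finite set \<Rightarrow> _)"
proof (rule injI)
  fix e f :: "'v set"
  assume "edge_monom e = edge_monom f"
  then have "(if w \<in> e then 1 else 0 :: nat) = (if w \<in> f then 1 else 0)" for w
    by (metis lookup_edge_monom)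
  then show "e = f" by (metis one_neq_zero set_eqI)
qed

lemma edge_monom_doubleton: "u \<noteq> v \<Longrightarrow> edge_monom {u, v} = var u + var v"
  by (simp add: edge_monom_def)

lemma lookup_mlcm_edge_monom:
  "Poly_Mapping.lookup (mlcm (edge_monom ` S)) w = (if w \<in> \<Union>S then 1 else 0)"
proof -
  let ?M = "insert 0 ((\<lambda>e. if w \<in> e then 1 else 0 :: nat) ` S)"
  have "Poly_Mapping.lookup (mlcm (edge_monom ` S)) w = Max ?M"
    by (simp add: lookup_mlcm image_image lookup_edge_monom)
  also have "?M = (if w \<in> \<Union>S then {0, 1} \<union> ?M else {0})" by (auto split: if_splits)
  also have "Max \<dots> = (if w \<in> \<Union>S then 1 else 0)"
    by (auto intro!: Max_eqI split: if_splits)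
  finally show ?thesis .
qed

lemma mlcm_edge_monom_eq_iff:
  "mlcm (edge_monom ` S) = mlcm (edge_monom ` T) \<longleftrightarrow> \<Union>S = \<Union>T"
proof
  assume *: "mlcm (edge_monom ` S) = mlcm (edge_monom ` T)"
  have "(if w \<in> \<Union>S then 1 else 0 :: nat) = (if w \<in> \<Union>T then 1 else 0)" for w
    using arg_cong[OF *, of "\<lambda>m. Poly_Mapping.lookup m w"] unfolding lookup_mlcm_edge_monom .
  then show "\<Union>S = \<Union>T" by (metis one_neq_zero set_eqI)
next
  assume "\<Union>S = \<Union>T"
  then show "mlcm (edge_monom ` S) = mlcm (edge_monom ` T)"
    by (intro poly_mapping_eqI) (simp only: lookup_mlcm_edge_monom)
qed

text \<open>The polynomials all of whose monomials are multiples of generators form an ideal; induction over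
  the span shows that the edge ideal lies in it.\<close>

lemma monom_in_edge_ideal_iff:
  assumes "simple_graph E"
  shows "(monom m :: ('v::finite, 'k::field) polynomial) \<in> edge_ideal E \<longleftrightarrow>
    (\<exists>e\<in>E. mdvd (edge_monom e) m)"
proof -
  interpret M: module "(*) :: ('v, 'k) polynomial \<Rightarrow> _"
    by unfold_locales (simp_all add: algebra_simps)
  let ?B = "{monom (var u + var v) | u v. {u, v} \<in> E} :: ('v, 'k) polynomial set"
  have gen: "?B = (\<lambda>e. monom (edge_monom e)) ` E"
  proof (intro set_eqI iffI)
    fix q assume "q \<in> ?B"
    then obtain u v where uv: "q = monom (var u + var v)" "{u, v} \<in> E" by blast
    then have "u \<noteq> v" using assms by (fastforce simp: simple_graph_def)
    then have "q = monom (edge_monom {u, v})" using uv(1) by (simp add: edge_monom_doubleton)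
    then show "q \<in> (\<lambda>e. monom (edge_monom e)) ` E" using uv(2) by blast
  next
    fix q :: "('v, 'k) polynomial" assume "q \<in> (\<lambda>e. monom (edge_monom e)) ` E"
    then obtain e where e: "e \<in> E" "q = monom (edge_monom e)" by blast
    then obtain u v where "e = {u, v}" "u \<noteq> v"
      using assms by (meson card_2_iff simple_graph_def)
    then have "q = monom (var u + var v)" "{u, v} \<in> E"
      using e by (simp_all add: edge_monom_doubleton)
    then show "q \<in> ?B" by blast
  qed
  have ei: "edge_ideal E = M.span ((\<lambda>e. monom (edge_monom e)) ` E)"
    unfolding edge_ideal_def ideal_generated_def gen ..
  have keys: "\<exists>e\<in>E. mdvd (edge_monom e) k"
    if "q \<in> M.span ((\<lambda>e. monom (edge_monom e)) ` E)" "k \<in> Poly_Mapping.keys q" for q k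
    using that
  proof (induction arbitrary: k rule: M.span_induct_alt)
    case base
    then show ?case by simp
  next
    case (step c x y)
    from step.prems consider "k \<in> Poly_Mapping.keys (c * x)" | "k \<in> Poly_Mapping.keys y"
      using Poly_Mapping.keys_add[of "c * x" y] by auto
    then show ?case
    proof cases
      case 1
      from step.hyps obtain e where e: "e \<in> E" "x = monom (edge_monom e)" by blast
      from 1 obtain i j where "k = i + j" "j \<in> Poly_Mapping.keys x"
        using keys_mult[of c x] by auto
      then have "k = i + edge_monom e" using e by (simp add: monom_def)
      then have "mdvd (edge_monom e) k" by (simp add: mdvd_def lookup_add)
      then show ?thesis using e by blast
    next
      case 2
      then show ?thesis using step.IH by blast
    qed
  qed
  show ?thesis
  proof
    assume "(monom m :: ('v, 'k) polynomial) \<in> edge_ideal E"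
    then show "\<exists>e\<in>E. mdvd (edge_monom e) m"
      using keys[of "monom m" m] by (simp add: ei monom_def)
  next
    assume "\<exists>e\<in>E. mdvd (edge_monom e) m"
    then obtain e where e: "e \<in> E" "mdvd (edge_monom e) m" by blast
    have "m = (m - edge_monom e) + edge_monom e"
      using e(2) by (intro poly_mapping_eqI) (simp add: mdvd_def lookup_add lookup_minus)
    then have "(monom m :: ('v, 'k) polynomial) = monom (m - edge_monom e) * monom (edge_monom e)"
      by (simp add: monom_def mult_single)
    then show "(monom m :: ('v, 'k) polynomial) \<in> edge_ideal E"
      unfolding ei using e(1) by (metis M.span_base M.span_scale imageI)
  qed
qed

lemma mdvd_edge_monom_iff: "mdvd (edge_monom e) (edge_monom f) \<longleftrightarrow> e \<subseteq> f"
  by (auto simp: mdvd_def lookup_edge_monom)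

text \<open>No generator divides another one, because the edges all have two elements.\<close>

lemma min_gens_edge_ideal:
  assumes "simple_graph E"
  shows "min_gens (edge_ideal E :: ('v::finite, 'k::field) polynomial set) = edge_monom ` E"
proof (intro set_eqI iffI)
  have refl: "mdvd m m" for m :: "'v monomial" by (simp add: mdvd_def)
  have anti: "m = m'" if "mdvd m m'" "mdvd m' m" for m m' :: "'v monomial"
    using that by (intro poly_mapping_eqI) (simp add: mdvd_def eq_iff)
  have trans: "mdvd l n" if "mdvd l m" "mdvd m n" for l m n :: "'v monomial"
    using that le_trans unfolding mdvd_def by blast
  {
    fix m assume m: "m \<in> min_gens (edge_ideal E :: ('v, 'k) polynomial set)"
    then obtain e where e: "e \<in> E" "mdvd (edge_monom e) m"
      by (auto simp: min_gens_def monom_in_edge_ideal_iff[OF assms])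
    moreover have "(monom (edge_monom e) :: ('v, 'k) polynomial) \<in> edge_ideal E"
      using e(1) refl by (auto simp: monom_in_edge_ideal_iff[OF assms])
    ultimately have "edge_monom e = m" using m by (simp add: min_gens_def)
    then show "m \<in> edge_monom ` E" using e(1) by blast
  next
    fix m assume "m \<in> edge_monom ` E"
    then obtain e where e: "e \<in> E" "m = edge_monom e" by blast
    have "m' = m" if "\<exists>f\<in>E. mdvd (edge_monom f) m'" "mdvd m' m" for m'
    proof -
      from that obtain f where f: "f \<in> E" "mdvd (edge_monom f) m'" by blast
      then have "f \<subseteq> e" using trans[OF f(2) that(2)] e by (simp add: mdvd_edge_monom_iff)
      moreover have "card f = card e" using assms e f by (simp add: simple_graph_def)
      ultimately have "f = e" by (simp add: card_subset_eq)
      then show "m' = m" using anti f that e by blast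
    qed
    then show "m \<in> min_gens (edge_ideal E :: ('v, 'k) polynomial set)"
      unfolding min_gens_def mem_Collect_eq monom_in_edge_ideal_iff[OF assms]
      using e refl by blast
  }
qed

section \<open>Bridge-friendliness as absence of conflicts\<close>

definition redundant :: "'v set set \<Rightarrow> 'v set \<Rightarrow> bool" where
  "redundant \<sigma> e \<longleftrightarrow> e \<in> \<sigma> \<and> e \<subseteq> \<Union>(\<sigma> - {e})"

text \<open>A bridge dominating no true gap exists exactly if the smallest bridge dominates none, since that
  one dominates the fewest edges. So \<open>\<sigma>\<close> is potentially-type-2 precisely if it has a critical
  edge \<open>a\<close>, and then \<open>a\<close> is its smallest bridge.\<close>

definition critical ::
  "'v set set \<Rightarrow> ('v set \<Rightarrow> nat) \<Rightarrow> 'v set set \<Rightarrow> 'v set \<Rightarrow> bool" where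
  "critical E g \<sigma> a \<longleftrightarrow> redundant \<sigma> a \<and> (\<forall>e. redundant \<sigma> e \<longrightarrow> g a \<le> g e) \<and>
     (\<forall>h\<in>E - \<sigma>. h \<subseteq> \<Union>\<sigma> \<and> g h < g a \<longrightarrow>
        (\<exists>e. redundant (insert h \<sigma>) e \<and> g e < g h \<and> \<not> redundant \<sigma> e))"

definition conflict ::
  "'v set set \<Rightarrow> ('v set \<Rightarrow> nat) \<Rightarrow> 'v set set \<Rightarrow> 'v set \<Rightarrow> 'v set \<Rightarrow> bool" where
  "conflict E g \<tau> a b \<longleftrightarrow> \<tau> \<subseteq> E \<and> a \<in> E - \<tau> \<and> b \<in> E - \<tau> \<and> a \<noteq> b \<and>
     critical E g (insert a \<tau>) a \<and> critical E g (insert b \<tau>) b"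

lemma bridge_edge_monom_iff:
  fixes S :: "'v::finite set set"
  shows "bridge (edge_monom ` S) m \<longleftrightarrow> (\<exists>e. m = edge_monom e \<and> redundant S e)"
proof -
  have "bridge (edge_monom ` S) (edge_monom e) \<longleftrightarrow> redundant S e" for e :: "'v set"
  proof -
    have "edge_monom ` S - {edge_monom e} = edge_monom ` (S - {e})"
      by (simp add: inj_edge_monom image_set_diff)
    moreover have "e \<in> S \<Longrightarrow> \<Union>(S - {e}) = \<Union>S \<longleftrightarrow> e \<subseteq> \<Union>(S - {e})" by blast
    ultimately show ?thesis
      unfolding bridge_def redundant_def
      by (metis inj_edge_monom inj_image_mem_iff mlcm_edge_monom_eq_iff)
  qed
  moreover have "bridge (edge_monom ` S) m \<Longrightarrow> m \<in> edge_monom ` S" by (simp add: bridge_def)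
  ultimately show ?thesis by blast
qed

lemma gap_edge_monom_iff:
  fixes S :: "'v::finite set set"
  shows "gap (edge_monom ` E) (edge_monom ` S) m \<longleftrightarrow> (\<exists>h\<in>E - S. m = edge_monom h \<and> h \<subseteq> \<Union>S)"
proof -
  have "gap (edge_monom ` E) (edge_monom ` S) (edge_monom h) \<longleftrightarrow> h \<in> E - S \<and> h \<subseteq> \<Union>S"
    for h :: "'v set"
  proof -
    have "edge_monom ` S \<union> {edge_monom h} = edge_monom ` (insert h S)" by simp
    then have "mlcm (edge_monom ` S \<union> {edge_monom h}) = mlcm (edge_monom ` S) \<longleftrightarrow> h \<subseteq> \<Union>S"
      by (simp only: mlcm_edge_monom_eq_iff) blast
    then show ?thesis
      unfolding gap_def by (simp add: inj_image_mem_iff[OF inj_edge_monom])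
  qed
  moreover have "gap (edge_monom ` E) (edge_monom ` S) m \<Longrightarrow> m \<in> edge_monom ` E"
    by (auto simp: gap_def)
  ultimately show ?thesis by blast
qed

lemma obtain_least_value:
  fixes g :: "'a \<Rightarrow> nat"
  assumes "P x"
  obtains y where "P y" "\<And>z. P z \<Longrightarrow> g y \<le> g z"
  using assms arg_min_nat_lemma[of P x g] by blast

text \<open>In a conflict both sets are potentially-type-2 with the same rest, and the type-2 conditions of
  the two contradict each other. Without conflicts, the type-2 condition holds vacuously.\<close>

lemma all_type2_iff_no_conflict:
  fixes E :: "'v::finite set set"
  assumes r: "\<And>e f. e \<in> E \<Longrightarrow> f \<in> E \<Longrightarrow> (edge_monom e, edge_monom f) \<in> r \<longleftrightarrow> g e \<le> g f"
    and g: "inj_on g E"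
  shows "(\<forall>\<sigma>\<subseteq>edge_monom ` E. potentially_type2 (edge_monom ` E) r \<sigma> \<longrightarrow>
      type2 (edge_monom ` E) r \<sigma>) \<longleftrightarrow> (\<forall>\<tau> a b. \<not> conflict E g \<tau> a b)"
proof -
  let ?A = "edge_monom ` E"
  have dom: "dominates r (edge_monom f) (edge_monom e) \<longleftrightarrow> g e < g f" if "e \<in> E" "f \<in> E" for e f
  proof -
    have "edge_monom f = edge_monom e \<longleftrightarrow> g f = g e"
      using that g inj_edge_monom by (metis inj_on_contraD injD)
    then show ?thesis unfolding dominates_def using r[OF that] by auto
  qed
  have tg: "true_gap ?A r (edge_monom ` S) m \<longleftrightarrow> (\<exists>h\<in>E - S. m = edge_monom h \<and> h \<subseteq> \<Union>S \<and>
      (\<forall>e. redundant (insert h S) e \<and> g e < g h \<longrightarrow> redundant S e))" if S: "S \<subseteq> E" for S m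
  proof -
    have *: "(\<forall>m'. bridge (edge_monom ` S \<union> {edge_monom h}) m' \<and> dominates r (edge_monom h) m' \<longrightarrow>
        bridge (edge_monom ` S) m') \<longleftrightarrow>
        (\<forall>e. redundant (insert h S) e \<and> g e < g h \<longrightarrow> redundant S e)" if h: "h \<in> E" for h
    proof -
      have ins: "edge_monom ` S \<union> {edge_monom h} = edge_monom ` (insert h S)" by simp
      have E: "e \<in> E" if "redundant (insert h S) e" for e
        using that h S by (auto simp: redundant_def)
      have inj: "edge_monom e = edge_monom f \<longleftrightarrow> e = f" for e f :: "'v set"
        using inj_edge_monom by (auto dest: injD)
      show ?thesis unfolding ins bridge_edge_monom_iff using dom[OF _ h] E inj by metis
    qed
    show ?thesis unfolding true_gap_def gap_edge_monom_iff using * by blast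
  qed
  have crit_E: "a \<in> E" if "critical E g S a" "S \<subseteq> E" for S a
    using that by (auto simp: critical_def redundant_def)
  have pt2: "potentially_type2 ?A r (edge_monom ` S) \<longleftrightarrow> (\<exists>a. critical E g S a)"
    if S: "S \<subseteq> E" for S
  proof
    assume "potentially_type2 ?A r (edge_monom ` S)"
    then obtain e where e: "redundant S e"
      and no: "\<And>m. true_gap ?A r (edge_monom ` S) m \<Longrightarrow> \<not> dominates r (edge_monom e) m"
      unfolding potentially_type2_def bridge_edge_monom_iff by blast
    obtain a where a: "redundant S a" "\<And>f. redundant S f \<Longrightarrow> g a \<le> g f"
      using obtain_least_value[of "redundant S", OF e] by blast
    have "critical E g S a"
      unfolding critical_def
    proof (intro conjI allI impI ballI)
      fix h assume h: "h \<in> E - S" "h \<subseteq> \<Union>S \<and> g h < g a"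
      then have "g h < g e" using a e by (meson less_le_trans)
      moreover have "e \<in> E" using e S by (auto simp: redundant_def)
      ultimately have "\<not> true_gap ?A r (edge_monom ` S) (edge_monom h)"
        using no dom h by blast
      then show "\<exists>e. redundant (insert h S) e \<and> g e < g h \<and> \<not> redundant S e"
        unfolding tg[OF S] using h by blast
    qed (use a in auto)
    then show "\<exists>a. critical E g S a" ..
  next
    assume "\<exists>a. critical E g S a"
    then obtain a where a: "critical E g S a" ..
    have "\<not> dominates r (edge_monom a) m" if "true_gap ?A r (edge_monom ` S) m" for m
    proof -
      from that obtain h where h: "h \<in> E - S" "m = edge_monom h" "h \<subseteq> \<Union>S"
        "\<forall>e. redundant (insert h S) e \<and> g e < g h \<longrightarrow> redundant S e"
        unfolding tg[OF S] by blast
      then have "\<not> g h < g a" using a unfolding critical_def by blast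
      then show ?thesis using dom[of h a] h crit_E[OF a S] by blast
    qed
    then show "potentially_type2 ?A r (edge_monom ` S)"
      unfolding potentially_type2_def bridge_edge_monom_iff
      using a unfolding critical_def by blast
  qed
  have sb: "smallest_bridge r (edge_monom ` S) = edge_monom a"
    if a: "critical E g S a" and S: "S \<subseteq> E" for S a
    unfolding smallest_bridge_def
  proof (rule the_equality)
    have red_E: "e \<in> E" if "redundant S e" for e using that S by (auto simp: redundant_def)
    show "bridge (edge_monom ` S) (edge_monom a) \<and>
        (\<forall>m'. bridge (edge_monom ` S) m' \<longrightarrow> (edge_monom a, m') \<in> r)"
      unfolding bridge_edge_monom_iff using a r red_E unfolding critical_def by blast
    fix m assume "bridge (edge_monom ` S) m \<and> (\<forall>m'. bridge (edge_monom ` S) m' \<longrightarrow> (m, m') \<in> r)"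
    then obtain e where e: "m = edge_monom e" "redundant S e" "(edge_monom e, edge_monom a) \<in> r"
      unfolding bridge_edge_monom_iff using a unfolding critical_def by blast
    then have "g e \<le> g a" using r red_E a unfolding critical_def by blast
    then have "g e = g a" using e a unfolding critical_def by (simp add: order_antisym)
    then show "m = edge_monom a" using e g red_E a unfolding critical_def by (metis inj_onD)
  qed
  show ?thesis
  proof (intro iffI allI impI notI)
    fix \<tau> a b
    assume all: "\<forall>\<sigma>\<subseteq>?A. potentially_type2 ?A r \<sigma> \<longrightarrow> type2 ?A r \<sigma>"
      and con: "conflict E g \<tau> a b"
    then have sub: "insert a \<tau> \<subseteq> E" "insert b \<tau> \<subseteq> E"
      and crit: "critical E g (insert a \<tau>) a" "critical E g (insert b \<tau>) b"
      and ne: "a \<noteq> b" "a \<notin> \<tau>" "b \<notin> \<tau>" by (auto simp: conflict_def)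
    let ?a = "edge_monom ` insert a \<tau>" and ?b = "edge_monom ` insert b \<tau>"
    have sba: "smallest_bridge r ?a = edge_monom a" using sb[OF crit(1) sub(1)] .
    have sbb: "smallest_bridge r ?b = edge_monom b" using sb[OF crit(2) sub(2)] .
    have p: "potentially_type2 ?A r ?a" "potentially_type2 ?A r ?b"
      using pt2 sub crit by blast+
    have tau: "insert a \<tau> - {a} = insert b \<tau> - {b}" using ne by blast
    have eq: "?a - {smallest_bridge r ?a} = ?b - {smallest_bridge r ?b}"
    proof -
      have "?a - {edge_monom a} = edge_monom ` (insert a \<tau> - {a})"
        using image_set_diff[OF inj_edge_monom, of "insert a \<tau>" "{a}"] by simp
      moreover have "?b - {edge_monom b} = edge_monom ` (insert b \<tau> - {b})"
        using image_set_diff[OF inj_edge_monom, of "insert b \<tau>" "{b}"] by simp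
      ultimately show ?thesis unfolding sba sbb tau by simp
    qed
    have "insert a \<tau> \<noteq> insert b \<tau>" using ne by blast
    then have neq: "?a \<noteq> ?b" using inj_edge_monom by (metis inj_image_eq_iff)
    have subA: "?a \<subseteq> ?A" "?b \<subseteq> ?A" using sub by blast+
    have "type2 ?A r ?a" "type2 ?A r ?b" using all p subA by blast+
    then have "dominates r (smallest_bridge r ?b) (smallest_bridge r ?a)"
      "dominates r (smallest_bridge r ?a) (smallest_bridge r ?b)"
      unfolding type2_def using p subA eq neq by metis+
    then have "g a < g b" "g b < g a" unfolding sba sbb using dom sub by blast+
    then show False by simp
  next
    fix \<sigma> assume nc: "\<forall>\<tau> a b. \<not> conflict E g \<tau> a b"
      and \<sigma>: "\<sigma> \<subseteq> ?A" and p: "potentially_type2 ?A r \<sigma>"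
    obtain S where S: "S \<subseteq> E" "\<sigma> = edge_monom ` S" using \<sigma> by (meson subset_imageE)
    obtain a where a: "critical E g S a" using pt2[OF S(1)] p S(2) by blast
    have "\<sigma>' = \<sigma>" if \<sigma>': "\<sigma>' \<subseteq> ?A" "potentially_type2 ?A r \<sigma>'"
      and eq: "\<sigma>' - {smallest_bridge r \<sigma>'} = \<sigma> - {smallest_bridge r \<sigma>}" for \<sigma>'
    proof -
      obtain T where T: "T \<subseteq> E" "\<sigma>' = edge_monom ` T" using \<sigma>' by (meson subset_imageE)
      obtain b where b: "critical E g T b" using pt2[OF T(1)] \<sigma>' T(2) by blast
      have mem: "a \<in> S" "b \<in> T" using a b by (auto simp: critical_def redundant_def)
      have "edge_monom ` (S - {a}) = edge_monom ` (T - {b})"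
        using eq unfolding S T sb[OF a S(1)] sb[OF b T(1)]
        by (simp add: image_set_diff inj_edge_monom)
      then have d: "S - {a} = T - {b}" using inj_edge_monom by (metis inj_image_eq_iff)
      have eqs: "insert a (S - {a}) = S" "insert b (S - {a}) = T" using mem d by blast+
      have "S - {a} \<subseteq> E" "a \<in> E - (S - {a})" "b \<in> E - (S - {a})"
        using S(1) T(1) mem d by blast+
      then have "conflict E g (S - {a}) a b" if "a \<noteq> b"
        unfolding conflict_def eqs using a b that by blast
      then have "a = b" using nc by blast
      then show ?thesis using S(2) T(2) eqs by metis
    qed
    then show "type2 ?A r \<sigma>" unfolding type2_def using p by blast
  qed
qed

lemma bridge_friendly_edge_ideal_iff:
  fixes E :: "'v::finite set set"
  assumes "simple_graph E"
  shows "bridge_friendly (edge_ideal E :: ('v, 'k::field) polynomial set) \<longleftrightarrow>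
    (\<exists>g. inj_on g E \<and> (\<forall>\<tau> a b. \<not> conflict E g \<tau> a b))"
proof
  let ?A = "edge_monom ` E"
  assume "bridge_friendly (edge_ideal E :: ('v, 'k) polynomial set)"
  then obtain r where lin: "linear_order_on ?A r"
    and all: "\<forall>\<sigma>\<subseteq>?A. potentially_type2 ?A r \<sigma> \<longrightarrow> type2 ?A r \<sigma>"
    unfolding bridge_friendly_def min_gens_edge_ideal[OF assms] by blast
  define below where "below e = {f \<in> E. (edge_monom f, edge_monom e) \<in> r}" for e
  define g where "g e = card (below e)" for e
  have refl: "(edge_monom e, edge_monom e) \<in> r" if "e \<in> E" for e
    using lin that by (auto simp: order_on_defs refl_on_def)
  have total: "(edge_monom e, edge_monom f) \<in> r \<or> (edge_monom f, edge_monom e) \<in> r"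
    if "e \<in> E" "f \<in> E" for e f
    using lin that refl by (cases "e = f") (auto simp: order_on_defs total_on_def inj_eq[OF inj_edge_monom])
  have trans: "trans r" and anti: "antisym r" using lin by (auto simp: order_on_defs)
  have le: "g e \<le> g f" if "(edge_monom e, edge_monom f) \<in> r" for e f
    unfolding g_def below_def using that trans
    by (intro card_mono) (auto dest: transD)
  have less: "g e < g f" if "(edge_monom e, edge_monom f) \<in> r" "e \<noteq> f" "f \<in> E" for e f
  proof -
    have "f \<notin> below e"
      using anti that injD[OF inj_edge_monom] unfolding below_def antisym_def by blast
    moreover have "f \<in> below f" using refl that by (simp add: below_def)
    moreover have "below e \<subseteq> below f" using that trans by (auto simp: below_def dest: transD)
    ultimately have "below e \<subset> below f" by blast
    then show ?thesis unfolding g_def by (simp add: psubset_card_mono)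
  qed
  have inj: "inj_on g E"
  proof (rule inj_onI, rule ccontr)
    fix e f assume ef: "e \<in> E" "f \<in> E" "g e = g f" "e \<noteq> f"
    from total[OF ef(1,2)] have "g e < g f \<or> g f < g e" using less ef by blast
    then show False using ef(3) by simp
  qed
  have "(edge_monom e, edge_monom f) \<in> r \<longleftrightarrow> g e \<le> g f" if "e \<in> E" "f \<in> E" for e f
  proof
    assume "g e \<le> g f"
    then have "(edge_monom f, edge_monom e) \<in> r \<Longrightarrow> e = f" using less[of f e] that by fastforce
    then show "(edge_monom e, edge_monom f) \<in> r" using total[OF that] refl[OF that(1)] by blast
  qed (rule le)
  from all_type2_iff_no_conflict[OF this inj] all
  have "\<forall>\<tau> a b. \<not> conflict E g \<tau> a b" by simp
  with inj show "\<exists>g. inj_on g E \<and> (\<forall>\<tau> a b. \<not> conflict E g \<tau> a b)" by blast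
next
  let ?A = "edge_monom ` E"
  assume "\<exists>g. inj_on g E \<and> (\<forall>\<tau> a b. \<not> conflict E g \<tau> a b)"
  then obtain g where g: "inj_on g E" and nc: "\<forall>\<tau> a b. \<not> conflict E g \<tau> a b" by blast
  define r where "r = {(edge_monom e, edge_monom f) | e f. e \<in> E \<and> f \<in> E \<and> g e \<le> g f}"
  have r: "(edge_monom e, edge_monom f) \<in> r \<longleftrightarrow> g e \<le> g f" if "e \<in> E" "f \<in> E" for e f
    unfolding r_def using that by (auto simp: inj_eq[OF inj_edge_monom])
  have "linear_order_on ?A r"
    unfolding order_on_defs
  proof (intro conjI)
    show "refl_on ?A r" by (auto simp: refl_on_def r)
    show "r \<subseteq> ?A \<times> ?A" by (auto simp: r_def)
    show "trans r"
      by (rule transI) (force simp: r_def inj_eq[OF inj_edge_monom])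
    show "antisym r"
      using g by (intro antisymI) (auto simp: r_def inj_eq[OF inj_edge_monom] inj_on_def)
    show "total_on ?A r" by (auto simp: total_on_def r)
  qed
  moreover from all_type2_iff_no_conflict[OF r g] nc
  have "\<forall>\<sigma>\<subseteq>?A. potentially_type2 ?A r \<sigma> \<longrightarrow> type2 ?A r \<sigma>" by simp
  ultimately show "bridge_friendly (edge_ideal E :: ('v, 'k) polynomial set)"
    unfolding bridge_friendly_def min_gens_edge_ideal[OF assms] by blast
qed

section \<open>The shape of a conflict\<close>

lemma critical_least: "critical E g \<sigma> a \<Longrightarrow> redundant \<sigma> e \<Longrightarrow> g a \<le> g e"
  by (simp add: critical_def)

lemma critical_gapE:
  assumes "critical E g \<sigma> a" "h \<in> E" "h \<notin> \<sigma>" "h \<subseteq> \<Union>\<sigma>" "g h < g a"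
  obtains e where "redundant (insert h \<sigma>) e" "g e < g h" "\<not> redundant \<sigma> e"
proof -
  have "\<forall>h\<in>E - \<sigma>. h \<subseteq> \<Union>\<sigma> \<and> g h < g a \<longrightarrow>
      (\<exists>e. redundant (insert h \<sigma>) e \<and> g e < g h \<and> \<not> redundant \<sigma> e)"
    using assms(1) by (simp add: critical_def)
  then have "\<exists>e. redundant (insert h \<sigma>) e \<and> g e < g h \<and> \<not> redundant \<sigma> e"
    using assms(2-5) by (metis DiffI)
  then show thesis using that by blast
qed

lemma conflict_sym: "conflict E g \<tau> a b \<Longrightarrow> conflict E g \<tau> b a"
  by (auto simp: conflict_def)

text \<open>The edge \<open>{x, y}\<close> is the new bridge that prevents the lighter of \<open>a\<close> and \<open>b\<close> from being
  a true gap of the set containing the heavier one. It is a bridge neither of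
  \<open>insert a \<tau>\<close> nor, being lighter than the smallest bridge \<open>b\<close>, of
  \<open>insert b \<tau>\<close>; so each of \<open>a\<close> and \<open>b\<close> is needed to cover one of its endpoints.\<close>

lemma conflict_middle_edge:
  assumes simple: "simple_graph E" and inj: "inj_on g E" and con: "conflict E g \<tau> a b"
  obtains x y z w where "{x, y} \<in> \<tau>" "a = {x, z}" "b = {y, w}" "z \<notin> {x, y}" "w \<notin> {x, y}"
    "\<forall>e\<in>\<tau>. x \<in> e \<or> y \<in> e \<longrightarrow> e = {x, y}" "z \<in> \<Union>\<tau>" "w \<in> \<Union>\<tau>"
    "g {x, y} < g a" "g {x, y} < g b"
proof -
  define P where "P a b x y z w \<longleftrightarrow> {x, y} \<in> \<tau> \<and> a = {x, z} \<and> b = {y, w} \<and>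
    z \<notin> {x, y} \<and> w \<notin> {x, y} \<and> (\<forall>e\<in>\<tau>. x \<in> e \<or> y \<in> e \<longrightarrow> e = {x, y}) \<and>
    z \<in> \<Union>\<tau> \<and> w \<in> \<Union>\<tau> \<and> g {x, y} < g a \<and> g {x, y} < g b" for a b x y z w
  have *: "\<exists>x y z w. P a b x y z w" if con: "conflict E g \<tau> a b" and ba: "g b < g a" for a b
  proof -
    have \<tau>: "\<tau> \<subseteq> E" and ab: "a \<in> E" "a \<notin> \<tau>" "b \<in> E" "b \<notin> \<tau>" "a \<noteq> b"
      and ca: "critical E g (insert a \<tau>) a" and cb: "critical E g (insert b \<tau>) b"
      using con by (auto simp: conflict_def)
    have cov: "a \<subseteq> \<Union>\<tau>" "b \<subseteq> \<Union>\<tau>"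
      using ca cb ab by (auto simp: critical_def redundant_def)
    have "b \<notin> insert a \<tau>" "b \<subseteq> \<Union>(insert a \<tau>)" using ab cov by auto
    from critical_gapE[OF ca ab(3) this ba]
    obtain c where c: "redundant (insert b (insert a \<tau>)) c" "g c < g b"
      "\<not> redundant (insert a \<tau>) c" by metis
    have nb: "\<not> redundant (insert b \<tau>) c" using critical_least[OF cb, of c] c(2) by auto
    have ne: "c \<noteq> a" "c \<noteq> b" using c(2) ba by auto
    then have c\<tau>: "c \<in> \<tau>" using c(1) by (simp add: redundant_def)
    have cov_c: "c \<subseteq> a \<union> b \<union> \<Union>(\<tau> - {c})" using c(1) by (auto simp: redundant_def)
    have "\<not> c \<subseteq> \<Union>(insert a \<tau> - {c})" using c(3) c\<tau> by (simp add: redundant_def)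
    then obtain y where y: "y \<in> c" "y \<in> b" "y \<notin> \<Union>(insert a \<tau> - {c})"
      using cov_c ne by blast
    have "\<not> c \<subseteq> \<Union>(insert b \<tau> - {c})" using nb c\<tau> by (simp add: redundant_def)
    then obtain x where x: "x \<in> c" "x \<in> a" "x \<notin> \<Union>(insert b \<tau> - {c})"
      using cov_c ne by blast
    have xy: "x \<noteq> y" using x y ne by blast
    have two: "card a = 2" "card b = 2" "card c = 2"
      using simple ab c\<tau> \<tau> by (auto simp: simple_graph_def)
    have ceq: "c = {x, y}"
      using two(3) x(1) y(1) xy by (auto simp: card_2_iff)
    obtain z where z: "a = {x, z}" "x \<noteq> z" using two(1) x(2)
      by (auto simp: card_2_iff insert_commute)
    obtain w where w: "b = {y, w}" "y \<noteq> w" using two(2) y(2)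
      by (auto simp: card_2_iff insert_commute)
    have "z \<noteq> y" "w \<noteq> x" using z w ne ceq by auto
    moreover have "\<forall>e\<in>\<tau>. x \<in> e \<or> y \<in> e \<longrightarrow> e = {x, y}" using x(3) y(3) ceq by blast
    moreover have "z \<in> \<Union>\<tau>" "w \<in> \<Union>\<tau>" using cov z(1) w(1) by blast+
    moreover have "g {x, y} < g a" "g {x, y} < g b" using c(2) ba ceq by auto
    ultimately have "P a b x y z w"
      using c\<tau> z w unfolding P_def ceq by blast
    then show ?thesis by blast
  qed
  have "g a \<noteq> g b" using inj con by (auto simp: conflict_def inj_on_def)
  then consider "g a < g b" | "g b < g a" by linarith
  then have "\<exists>x y z w. P a b x y z w"
  proof cases
    case 1
    then obtain x y z w where "P b a x y z w" using *[OF conflict_sym[OF con]] by blast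
    then have "P a b y x w z" unfolding P_def insert_commute[of y x "{}"] by blast
    then show ?thesis by blast
  next
    case 2
    then show ?thesis by (rule *[OF con])
  qed
  then obtain x y z w where P: "P a b x y z w" by blast
  show thesis by (rule that[of x y z w]) (use P in \<open>unfold P_def, blast+\<close>)
qed

text \<open>An edge \<open>d\<close> covered by two heavier edges of \<open>\<tau>\<close> cannot be lighter than a critical edge:
  inside \<open>\<tau>\<close> it would be a lighter bridge, outside it would be a true gap, since its
  endpoints are covered already and so only the two heavier edges can become bridges by adding it.\<close>

lemma no_covered_light_edge:
  assumes a: "critical E g (insert a \<tau>) a" and "d \<in> E" "d \<noteq> a"
    and fh: "f \<in> \<tau>" "h \<in> \<tau>" "d \<subseteq> f \<union> h" and less: "g d < g f" "g d < g h" "g d < g a"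
  shows False
proof (cases "d \<in> \<tau>")
  case True
  then have "redundant (insert a \<tau>) d" using fh less by (auto simp: redundant_def)
  then show False using critical_least[OF a] less by fastforce
next
  case False
  then have "d \<notin> insert a \<tau>" "d \<subseteq> \<Union>(insert a \<tau>)" using assms(3) fh by auto
  from critical_gapE[OF a assms(2) this less(3)]
  obtain e where e: "redundant (insert d (insert a \<tau>)) e" "g e < g d"
    "\<not> redundant (insert a \<tau>) e" by metis
  have "e \<noteq> f" "e \<noteq> h" "e \<noteq> d" using e less by auto
  then have "d \<subseteq> \<Union>(insert a \<tau> - {e})" using fh by auto
  moreover have "e \<in> insert a \<tau>" "e \<subseteq> d \<union> \<Union>(insert a \<tau> - {e})"
    using e(1) \<open>e \<noteq> d\<close> by (auto simp: redundant_def)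
  ultimately have "redundant (insert a \<tau>) e" unfolding redundant_def by blast
  then show False using e(3) by blast
qed

lemma card_2_other_element:
  assumes "card e = 2"
  obtains v where "v \<in> e" "v \<noteq> u"
proof -
  have "\<not> e \<subseteq> {u}" using assms card_mono[of "{u}" e] by auto
  then show thesis using that by blast
qed

text \<open>The four (or three) edges of \<open>{{x, y}, f, h} \<union> {{x, z}}\<close> form a path, or two disjoint
  paths, in which \<open>{x, z}\<close> is the only edge whose removal uncovers nothing. Its only gap is
  \<open>{y, w}\<close>, and this gap is not true because it turns \<open>{x, y}\<close> into a lighter bridge. The
  same holds for \<open>{y, w}\<close> by symmetry.\<close>

lemma conflict_of_local_minimum:
  assumes simple: "simple_graph E"
    and E: "{x, y} \<in> E" "{x, z} \<in> E" "{y, w} \<in> E" "f \<in> E" "h \<in> E"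
    and fh: "z \<in> f" "w \<in> h" "x \<notin> f \<union> h" "y \<notin> f \<union> h" "f = h \<or> f \<inter> h = {}"
    and induced: "\<And>e. e \<in> E \<Longrightarrow> e \<subseteq> {x, y} \<union> f \<union> h \<Longrightarrow> e \<in> {{x, y}, {x, z}, {y, w}, f, h}"
    and less: "g {x, y} < g {x, z}" "g {x, y} < g {y, w}"
  shows "conflict E g {{x, y}, f, h} {x, z} {y, w}"
proof -
  have crit: "critical E g (insert {x, z} {{x, y}, f, h}) {x, z}"
    if E: "{x, y} \<in> E" "{x, z} \<in> E" "{y, w} \<in> E" "f \<in> E" "h \<in> E"
      and fh: "z \<in> f" "w \<in> h" "x \<notin> f \<union> h" "y \<notin> f \<union> h" "f = h \<or> f \<inter> h = {}"
      and induced: "\<And>e. e \<in> E \<Longrightarrow> e \<subseteq> {x, y} \<union> f \<union> h \<Longrightarrow> e \<in> {{x, y}, {x, z}, {y, w}, f, h}"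
      and less: "g {x, y} < g {y, w}"
    for x y z w f h
  proof -
    let ?\<sigma> = "insert {x, z} {{x, y}, f, h}"
    have dist: "x \<noteq> y" "z \<noteq> x" "z \<noteq> y" "w \<noteq> x" "w \<noteq> y"
      using fh E(1) simple by (auto simp: simple_graph_def)
    have red: "redundant ?\<sigma> {x, z}" using fh dist by (auto simp: redundant_def doubleton_eq_iff)
    have only: "e = {x, z}" if e: "redundant ?\<sigma> e" for e
    proof (rule ccontr)
      assume ne: "e \<noteq> {x, z}"
      have e_cov: "e \<subseteq> \<Union>(?\<sigma> - {e})" using e unfolding redundant_def by (rule conjunct2)
      have "e \<in> ?\<sigma>" using e unfolding redundant_def by (rule conjunct1)
      then consider "e = {x, y}" | "e = f" | "e = h" using ne by blast
      then show False
      proof cases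
        case 1
        have "y \<in> \<Union>(?\<sigma> - {{x, y}})" using e_cov unfolding 1 by blast
        then show False using fh dist by auto
      next
        case 2
        have "card f = 2" using simple E by (simp add: simple_graph_def)
        then obtain z' where z': "z' \<in> f" "z' \<noteq> z" by (rule card_2_other_element)
        have "z' \<in> \<Union>(?\<sigma> - {f})" using e_cov z'(1) unfolding 2 by blast
        then show False using z' fh by auto
      next
        case 3
        have "card h = 2" using simple E by (simp add: simple_graph_def)
        then obtain w' where w': "w' \<in> h" "w' \<noteq> z" by (rule card_2_other_element)
        have "w' \<in> \<Union>(?\<sigma> - {h})" using e_cov w'(1) unfolding 3 by blast
        then show False using w' fh by auto
      qed
    qed
    show ?thesis
      unfolding critical_def
    proof (intro conjI allI impI ballI)
      fix k assume k: "k \<in> E - ?\<sigma>" "k \<subseteq> \<Union>?\<sigma> \<and> g k < g {x, z}"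
      have "\<Union>?\<sigma> \<subseteq> {x, y} \<union> f \<union> h" using fh(1) by auto
      then have "k \<subseteq> {x, y} \<union> f \<union> h" using k(2) by (meson order_trans)
      from induced[OF _ this] k(1) have "k = {y, w}" by blast
      moreover have "redundant (insert {y, w} ?\<sigma>) {x, y}"
      proof -
        have "{x, y} \<noteq> {x, z}" "{x, y} \<noteq> {y, w}" using dist by (auto simp: doubleton_eq_iff)
        then have "{x, y} \<subseteq> \<Union>(insert {y, w} ?\<sigma> - {{x, y}})" by blast
        then show ?thesis unfolding redundant_def by blast
      qed
      moreover have "\<not> redundant ?\<sigma> {x, y}"
        using only[of "{x, y}"] dist by (auto simp: doubleton_eq_iff)
      ultimately show "\<exists>e. redundant (insert k ?\<sigma>) e \<and> g e < g k \<and> \<not> redundant ?\<sigma> e"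
        using less by blast
    next
      fix e assume "redundant ?\<sigma> e"
      then show "g {x, z} \<le> g e" using only[of e] by simp
    qed (rule red)
  qed
  have 1: "critical E g (insert {x, z} {{x, y}, f, h}) {x, z}"
    using crit[OF E fh induced less(2)] by blast
  have yx: "{y, x} = {x, y}" by (rule insert_commute)
  have sym: "{{y, x}, {y, w}, {x, z}, h, f} = {{x, y}, {x, z}, {y, w}, f, h}"
    "{y, x} \<union> h \<union> f = {x, y} \<union> f \<union> h" "{{y, x}, h, f} = {{x, y}, f, h}"
    unfolding yx by blast+
  have "critical E g (insert {y, w} {{y, x}, h, f}) {y, w}"
  proof (rule crit[of y x w z h f])
    show "e \<in> {{y, x}, {y, w}, {x, z}, h, f}" if "e \<in> E" "e \<subseteq> {y, x} \<union> h \<union> f" for e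
      using induced[of e] that unfolding sym by blast
    show "h = f \<or> h \<inter> f = {}" using fh(5) by blast
  qed (use E fh less in \<open>simp_all add: yx\<close>)
  then have 2: "critical E g (insert {y, w} {{x, y}, f, h}) {y, w}" unfolding sym .
  have "x \<noteq> y" "z \<noteq> x" "z \<noteq> y" "w \<noteq> x" "w \<noteq> y"
    using fh E(1) simple by (auto simp: simple_graph_def)
  then have "{x, z} \<notin> {{x, y}, f, h}" "{y, w} \<notin> {{x, y}, f, h}" "{x, z} \<noteq> {y, w}"
    using fh(3,4) by (auto simp: doubleton_eq_iff)
  then show ?thesis unfolding conflict_def using 1 2 E by blast
qed

section \<open>Connected unicyclic graphs\<close>

definition adj :: "'v set set \<Rightarrow> 'v rel" where
  "adj F = {(x, y). {x, y} \<in> F}"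

lemma sym_adj: "sym (adj F)"
  by (auto simp: adj_def sym_def insert_commute)

lemma adj_rtrancl_sym: "(u, v) \<in> (adj F)\<^sup>* \<Longrightarrow> (v, u) \<in> (adj F)\<^sup>*"
  using sym_rtrancl[OF sym_adj] by (meson symD)

lemma adj_rtrancl_mono: "F \<subseteq> G \<Longrightarrow> (u, v) \<in> (adj F)\<^sup>* \<Longrightarrow> (u, v) \<in> (adj G)\<^sup>*"
  using rtrancl_mono[of "adj F" "adj G"] by (auto simp: adj_def)

lemma rtrancl_adj_path:
  assumes "(u, v) \<in> (adj F)\<^sup>*"
  shows "\<exists>ps. ps \<noteq> [] \<and> hd ps = u \<and> last ps = v \<and> distinct ps \<and>
    successively (\<lambda>x y. {x, y} \<in> F) ps"
  using assms
proof (induction rule: converse_rtrancl_induct)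
  case base
  show ?case by (intro exI[of _ "[v]"]) simp
next
  case (step u u')
  then obtain ps where ps: "ps \<noteq> []" "hd ps = u'" "last ps = v" "distinct ps"
    "successively (\<lambda>x y. {x, y} \<in> F) ps" by blast
  show ?case
  proof (cases "u \<in> set ps")
    case True
    then obtain xs ys where "ps = xs @ u # ys" by (meson split_list)
    then show ?thesis
      using ps by (intro exI[of _ "u # ys"]) (auto simp: successively_append_iff)
  next
    case False
    then show ?thesis
      using ps step.hyps(1) by (intro exI[of _ "u # ps"]) (auto simp: successively_Cons adj_def)
  qed
qed

lemma cycle_edges_rotate: "cycle_edges (rotate k p) = cycle_edges p"
proof -
  have sub: "cycle_edges (rotate k p) \<subseteq> cycle_edges p" for k and p :: "'a list"
  proof
    fix e assume "e \<in> cycle_edges (rotate k p)"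
    then obtain i where i: "i < length p"
      "e = {rotate k p ! i, rotate k p ! (Suc i mod length p)}"
      by (auto simp: cycle_edges_def)
    let ?n = "length p"
    have pos: "0 < ?n" using i by auto
    have "e = {p ! ((k + i) mod ?n), p ! ((k + Suc i mod ?n) mod ?n)}"
      using i pos by (simp add: nth_rotate)
    also have "(k + Suc i mod ?n) mod ?n = Suc ((k + i) mod ?n) mod ?n"
      by (simp add: mod_simps)
    finally show "e \<in> cycle_edges p"
      using pos unfolding cycle_edges_def by (auto intro!: exI[of _ "(k + i) mod ?n"])
  qed
  \<comment> \<open>The two rotations add up to a multiple of the length.\<close>
  have "p = rotate (k * (length p - 1)) (rotate k p)"
  proof (cases "p = []")
    case False
    then have "k * (length p - 1) + k = k * length p" by (cases "length p") auto
    then show ?thesis by (simp add: rotate_rotate rotate_id)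
  qed simp
  then show ?thesis using sub by (metis subset_antisym)
qed

text \<open>Ranks with ties are enough to specify an order: ties may be broken arbitrarily.\<close>

lemma injective_refinement:
  fixes t :: "'a \<Rightarrow> nat"
  assumes "finite A"
  obtains g :: "'a \<Rightarrow> nat" where "inj_on g A"
    "\<And>e f. e \<in> A \<Longrightarrow> f \<in> A \<Longrightarrow> t e < t f \<Longrightarrow> g e < g f"
proof -
  obtain h where h: "bij_betw h A {0..<card A}" using ex_bij_betw_finite_nat[OF assms] by blast
  define g where "g e = t e * card A + h e" for e
  have less: "g e < g f" if "e \<in> A" "f \<in> A" "t e < t f" for e f
  proof -
    have "h e < card A" using h that(1) by (auto simp: bij_betw_def)
    then have "g e < Suc (t e) * card A" by (simp add: g_def)
    also have "\<dots> \<le> t f * card A" using that(3) by (intro mult_right_mono) auto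
    also have "\<dots> \<le> g f" by (simp add: g_def)
    finally show ?thesis .
  qed
  have "inj_on g A"
  proof (rule inj_onI)
    fix e f assume ef: "e \<in> A" "f \<in> A" "g e = g f"
    then have "t e = t f" using less[of e f] less[of f e] by (cases rule: linorder_cases[of "t e" "t f"]) auto
    then have "h e = h f" using ef by (simp add: g_def)
    then show "e = f" using h ef by (auto simp: bij_betw_def inj_on_def)
  qed
  then show thesis using that less by blast
qed

locale unicyclic_graph =
  fixes E :: "'v::finite set set" and p :: "'v list"
  assumes simple: "simple_graph E" and connected: "connected_graph E"
    and unicyclic: "unicyclic E" and cycle: "is_cycle E p"
begin

abbreviation C :: "'v set set" where "C \<equiv> cycle_edges p"

lemma length_ge: "3 \<le> length p" and distinct_p: "distinct p" and C_subset: "C \<subseteq> E"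
  using cycle by (auto simp: is_cycle_def)

lemma nth_p_eq_iff: "i < length p \<Longrightarrow> j < length p \<Longrightarrow> p ! i = p ! j \<longleftrightarrow> i = j"
  using distinct_p by (rule nth_eq_iff_index_eq)

lemma edge_neq: "{u, v} \<in> E \<Longrightarrow> u \<noteq> v"
  using simple by (auto simp: simple_graph_def)

lemma edge_other_endpoint:
  assumes "e \<in> E" "u \<in> e"
  obtains v where "e = {u, v}" "v \<noteq> u"
proof -
  obtain a b where "e = {a, b}" "a \<noteq> b" using assms simple by (meson card_2_iff simple_graph_def)
  then show thesis using that assms(2) by (metis insert_commute insertE singletonD)
qed

lemma cycle_edge_subset: "e \<in> C \<Longrightarrow> e \<subseteq> set p"
  using length_ge by (auto simp: cycle_edges_def intro!: nth_mem mod_less_divisor)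

lemma rotate_locale: "unicyclic_graph E (rotate k p)"
  using simple connected unicyclic cycle
  by unfold_locales (auto simp: is_cycle_def cycle_edges_rotate)

lemma cycle_connected:
  assumes "u \<in> set p" "v \<in> set p"
  shows "(u, v) \<in> (adj C)\<^sup>*"
proof -
  have "i < length p \<Longrightarrow> (p ! 0, p ! i) \<in> (adj C)\<^sup>*" for i
  proof (induction i)
    case (Suc i)
    have "{p ! i, p ! Suc i} \<in> C"
      unfolding cycle_edges_def using Suc.prems by (auto intro!: exI[of _ i])
    then show ?case using Suc by (auto simp: adj_def intro: rtrancl_into_rtrancl)
  qed simp
  then have "(p ! 0, w) \<in> (adj C)\<^sup>*" if "w \<in> set p" for w
    using that by (metis in_set_conv_nth)
  then show ?thesis using assms adj_rtrancl_sym rtrancl_trans by metis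
qed

text \<open>A second connection between the endpoints would close up with the edge to a second cycle. All
  structural facts about the graph below rest on this one.\<close>

lemma noncycle_edge_disconnects:
  assumes e: "{u, v} \<in> E" "{u, v} \<notin> C"
  shows "(u, v) \<notin> (adj (E - {{u, v}}))\<^sup>*"
proof
  assume "(u, v) \<in> (adj (E - {{u, v}}))\<^sup>*"
  from rtrancl_adj_path[OF this] obtain ps where ps: "ps \<noteq> []" "hd ps = u" "last ps = v" "distinct ps"
    "successively (\<lambda>x y. {x, y} \<in> E - {{u, v}}) ps" by auto
  have nth: "{ps ! i, ps ! Suc i} \<in> E - {{u, v}}" if "Suc i < length ps" for i
    using ps(5) that by (simp add: successively_conv_nth)
  have ends: "ps ! 0 = u" "ps ! (length ps - 1) = v" using ps by (auto simp: hd_conv_nth last_conv_nth)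
  have len: "3 \<le> length ps"
  proof (rule ccontr)
    assume "\<not> 3 \<le> length ps"
    moreover have "length ps \<noteq> 0" using ps(1) by simp
    ultimately consider "length ps = 1" | "length ps = 2" by linarith
    then show False
    proof cases
      case 1
      then show False using ends edge_neq[OF e(1)] by simp
    next
      case 2
      then show False using ends nth[of 0] by simp
    qed
  qed
  have mem: "{u, v} \<in> cycle_edges ps"
  proof -
    have "Suc (length ps - 1) = length ps" using len by linarith
    then have "length ps - 1 < length ps" "Suc (length ps - 1) mod length ps = 0"
      by (linarith, metis mod_self)
    moreover from this have "{u, v} = {ps ! (length ps - 1), ps ! (Suc (length ps - 1) mod length ps)}"
      using ends by (simp add: insert_commute)
    ultimately show ?thesis unfolding cycle_edges_def by blast
  qed
  have "cycle_edges ps \<subseteq> E"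
  proof
    fix f assume "f \<in> cycle_edges ps"
    then obtain i where i: "i < length ps" "f = {ps ! i, ps ! (Suc i mod length ps)}"
      by (auto simp: cycle_edges_def)
    show "f \<in> E"
    proof (cases "Suc i < length ps")
      case True
      then show ?thesis using i nth[of i] by simp
    next
      case False
      then have "i = length ps - 1" using i by simp
      moreover have "Suc i mod length ps = 0" using False i by (metis Suc_lessI mod_self)
      ultimately show ?thesis using i ends e(1) by (simp add: insert_commute)
    qed
  qed
  then have "is_cycle E ps" using len ps(4) by (simp add: is_cycle_def)
  then have "cycle_edges ps = C" using unicyclic cycle unfolding unicyclic_def by blast
  then show False using mem e(2) by simp
qed

text \<open>The cycle itself connects the endpoints of a chord.\<close>

lemma no_chord:
  assumes "e \<in> E" "e \<subseteq> set p"
  shows "e \<in> C"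
proof (rule ccontr)
  assume "e \<notin> C"
  obtain u v where e: "e = {u, v}" using assms simple by (meson card_2_iff simple_graph_def)
  then have "(u, v) \<in> (adj C)\<^sup>*" using assms cycle_connected by blast
  moreover have "C \<subseteq> E - {{u, v}}" using C_subset e \<open>e \<notin> C\<close> by blast
  ultimately have "(u, v) \<in> (adj (E - {{u, v}}))\<^sup>*" using adj_rtrancl_mono by metis
  moreover have "{u, v} \<in> E" "{u, v} \<notin> C" using assms(1) \<open>e \<notin> C\<close> e by simp_all
  ultimately show False using noncycle_edge_disconnects by blast
qed

text \<open>Two attachments of \<open>q\<close> are connected by the cycle and the second edge, hence without
  \<open>{u, q}\<close>.\<close>

lemma attachment_unique:
  assumes "{u, q} \<in> E" "{v, q} \<in> E" "u \<in> set p" "v \<in> set p" "q \<notin> set p"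
  shows "u = v"
proof (rule ccontr)
  assume "u \<noteq> v"
  let ?F = "E - {{u, q}}"
  have nC: "{u, q} \<notin> C" using assms cycle_edge_subset by blast
  then have "C \<subseteq> ?F" using C_subset by blast
  then have "(u, v) \<in> (adj ?F)\<^sup>*"
    using cycle_connected[OF assms(3,4)] by (rule adj_rtrancl_mono)
  moreover have "(v, q) \<in> adj ?F" using assms \<open>u \<noteq> v\<close> by (auto simp: adj_def doubleton_eq_iff)
  ultimately have "(u, q) \<in> (adj ?F)\<^sup>*" by (rule rtrancl_into_rtrancl)
  then show False using noncycle_edge_disconnects[OF assms(1) nC] by blast
qed

text \<open>Otherwise \<open>u\<close> and \<open>q\<close> are connected through \<open>v\<close> and \<open>r\<close> without the edge
  \<open>{u, q}\<close>. The case \<open>u = v\<close> is included.\<close>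

lemma attached_vertices_nonadjacent:
  assumes "{u, q} \<in> E" "{v, r} \<in> E" "u \<in> set p" "v \<in> set p" "q \<notin> set p" "r \<notin> set p"
  shows "{q, r} \<notin> E"
proof
  assume qr: "{q, r} \<in> E"
  let ?F = "E - {{u, q}}"
  have nC: "{u, q} \<notin> C" using assms cycle_edge_subset by blast
  then have "C \<subseteq> ?F" using C_subset by blast
  then have "(u, v) \<in> (adj ?F)\<^sup>*"
    using cycle_connected[OF assms(3,4)] by (rule adj_rtrancl_mono)
  moreover have "(v, r) \<in> adj ?F"
    using assms edge_neq[OF qr] by (auto simp: adj_def doubleton_eq_iff)
  moreover have "(r, q) \<in> adj ?F"
    using assms qr by (auto simp: adj_def doubleton_eq_iff insert_commute)
  ultimately have "(u, q) \<in> (adj ?F)\<^sup>*" by (meson rtrancl_into_rtrancl)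
  then show False using noncycle_edge_disconnects[OF assms(1) nC] by blast
qed

lemma cycle_edges_at_head:
  "{e \<in> C. p ! 0 \<in> e} = {{p ! 0, p ! 1}, {p ! (length p - 1), p ! 0}}" (is "?L = ?R")
proof
  let ?n = "length p"
  have n: "3 \<le> ?n" by (rule length_ge)
  show "?R \<subseteq> ?L"
  proof -
    have "{p ! 0, p ! 1} \<in> C"
      unfolding cycle_edges_def using n by (auto intro!: exI[of _ 0])
    moreover have "{p ! (?n - 1), p ! 0} \<in> C"
    proof -
      have "Suc (?n - 1) = ?n" using n by linarith
      then have "?n - 1 < ?n" "Suc (?n - 1) mod ?n = 0" by (linarith, metis mod_self)
      then show ?thesis unfolding cycle_edges_def by fastforce
    qed
    ultimately show ?thesis by blast
  qed
  show "?L \<subseteq> ?R"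
  proof
    fix e assume "e \<in> ?L"
    then obtain i where i: "i < ?n" "e = {p ! i, p ! (Suc i mod ?n)}" "p ! 0 \<in> e"
      by (auto simp: cycle_edges_def)
    moreover have "0 < ?n" using n by linarith
    ultimately have "0 = i \<or> 0 = Suc i mod ?n"
      using nth_p_eq_iff[of 0 i] nth_p_eq_iff[of 0 "Suc i mod ?n"] by auto
    then show "e \<in> ?R"
    proof
      assume "0 = i"
      then show ?thesis using i n by simp
    next
      assume 0: "0 = Suc i mod ?n"
      then have "i = ?n - 1" using i n by (metis Suc_lessI diff_Suc_1 mod_less nat.distinct(1))
      then show ?thesis using i 0 by simp
    qed
  qed
qed

lemma degree_head_eq_2_iff: "degree E (p ! 0) = 2 \<longleftrightarrow> (\<forall>e\<in>E. p ! 0 \<in> e \<longrightarrow> e \<in> C)"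
proof -
  let ?S = "{e \<in> E. p ! 0 \<in> e}" and ?T = "{e \<in> C. p ! 0 \<in> e}"
  have "1 < length p" "0 < length p" "length p - 1 < length p" "1 \<noteq> length p - 1"
    using length_ge by linarith+
  then have "p ! 1 \<noteq> p ! (length p - 1)" "p ! 0 \<noteq> p ! 1" by (simp_all add: nth_p_eq_iff)
  then have "{p ! 0, p ! 1} \<noteq> {p ! (length p - 1), p ! 0}" by (auto simp: doubleton_eq_iff)
  then have T: "card ?T = 2" unfolding cycle_edges_at_head by simp
  have TS: "?T \<subseteq> ?S" using C_subset by blast
  have "card ?S = 2 \<longleftrightarrow> ?T = ?S"
  proof
    assume "card ?S = 2"
    then show "?T = ?S" using T TS by (intro card_subset_eq) simp_all
  next
    assume "?T = ?S"
    with T show "card ?S = 2" by simp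
  qed
  also have "\<dots> \<longleftrightarrow> (\<forall>e\<in>E. p ! 0 \<in> e \<longrightarrow> e \<in> C)" using C_subset by blast
  finally show ?thesis unfolding degree_def .
qed

text \<open>Two cycle edges meet at every cycle vertex, so degree \<open>2\<close> means that nothing is attached there.\<close>

lemma degree_eq_2_iff:
  assumes "v \<in> set p"
  shows "degree E v = 2 \<longleftrightarrow> (\<forall>e\<in>E. v \<in> e \<longrightarrow> e \<in> C)"
proof -
  obtain k where k: "k < length p" "v = p ! k" using assms by (metis in_set_conv_nth)
  interpret R: unicyclic_graph E "rotate k p" by (rule rotate_locale)
  have "0 < length p" using k(1) by linarith
  then have "rotate k p ! 0 = v" using k by (simp add: nth_rotate)
  then show ?thesis using R.degree_head_eq_2_iff by (simp add: cycle_edges_rotate)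
qed

lemma pendant_edge:
  assumes "v \<in> set p" "degree E v \<noteq> 2"
  obtains q where "{v, q} \<in> E" "q \<notin> set p"
proof -
  obtain e where e: "e \<in> E" "v \<in> e" "e \<notin> C" using degree_eq_2_iff assms by blast
  then obtain q where "e = {v, q}" using edge_other_endpoint by blast
  moreover have "\<not> e \<subseteq> set p" using e no_chord by blast
  ultimately show thesis using that e assms by auto
qed

text \<open>The vertices cut off from the cycle by removing \<open>e\<close>; the head of \<open>p\<close> stands for the cycle.
  The number of these vertices decreases towards the leaves and will rank the edges outside the
  cycle.\<close>

definition hanging :: "'v set \<Rightarrow> 'v set" where
  "hanging e = {v. (p ! 0, v) \<notin> (adj (E - {e}))\<^sup>*}"

lemma head_in_cycle: "p ! 0 \<in> set p"
  using length_ge by (auto intro!: nth_mem)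

lemma hanging_disjoint_cycle: "e \<in> E - C \<Longrightarrow> v \<in> set p \<Longrightarrow> v \<notin> hanging e"
  using cycle_connected[OF head_in_cycle, of v] adj_rtrancl_mono[of C "E - {e}"] C_subset
  by (auto simp: hanging_def)

text \<open>If both endpoints remained connected to the cycle, they would be connected to each other without
  \<open>e\<close>. If neither did, the part of the graph reachable from the cycle without \<open>e\<close> would be
  closed under all edges, against connectedness.\<close>

lemma outer_endpoint:
  assumes e: "e \<in> E - C"
  obtains u v where "e = {u, v}" "u \<notin> hanging e" "v \<in> hanging e"
proof -
  let ?r = "p ! 0" and ?A = "adj (E - {e})"
  obtain u v where uv: "e = {u, v}" using e simple by (meson DiffD1 card_2_iff simple_graph_def)
  have 1: "\<not> (u \<notin> hanging e \<and> v \<notin> hanging e)"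
  proof
    assume "u \<notin> hanging e \<and> v \<notin> hanging e"
    then have "(u, ?r) \<in> ?A\<^sup>*" "(?r, v) \<in> ?A\<^sup>*" using adj_rtrancl_sym by (auto simp: hanging_def)
    then have "(u, v) \<in> ?A\<^sup>*" by (rule rtrancl_trans)
    then show False using noncycle_edge_disconnects[of u v] e uv by auto
  qed
  have 2: "\<not> (u \<in> hanging e \<and> v \<in> hanging e)"
  proof
    assume hang: "u \<in> hanging e \<and> v \<in> hanging e"
    have "(?r, w) \<in> (adj E)\<^sup>* \<Longrightarrow> w \<notin> hanging e" for w
    proof (induction rule: rtrancl_induct)
      case base
      show ?case by (simp add: hanging_def)
    next
      case (step s t)
      have "{s, t} \<noteq> e" using step.IH hang uv by auto
      then have "(s, t) \<in> ?A" using step.hyps(2) by (simp add: adj_def)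
      then show ?case using step.IH by (auto simp: hanging_def intro: rtrancl_into_rtrancl)
    qed
    moreover have "(?r, u) \<in> (adj E)\<^sup>*" using connected by (simp add: connected_graph_def adj_def)
    ultimately show False using hang by blast
  qed
  show thesis using 1 2 uv that[of u v] that[of v u] by (auto simp: insert_commute)
qed

text \<open>The endpoint is the outer one. A walk that starts on the cycle and avoids \<open>e\<close> never gets to
  \<open>v\<close>, so it also avoids every other edge \<open>f\<close> at \<open>v\<close>; whatever hangs on \<open>f\<close> hangs
  on \<open>e\<close>, and \<open>v\<close> itself hangs only on \<open>e\<close>.\<close>

lemma hanging_decreases:
  assumes e: "e \<in> E - C"
  shows "\<exists>v\<in>e. \<forall>f\<in>E. v \<in> f \<and> f \<noteq> e \<longrightarrow> f \<notin> C \<and> card (hanging f) < card (hanging e)"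
proof -
  let ?r = "p ! 0"
  obtain u v where uv: "e = {u, v}" "u \<notin> hanging e" "v \<in> hanging e"
    using outer_endpoint[OF e] by blast
  have "f \<notin> C \<and> card (hanging f) < card (hanging e)" if f: "f \<in> E" "v \<in> f" "f \<noteq> e" for f
  proof
    show "f \<notin> C" using f cycle_edge_subset hanging_disjoint_cycle[OF e] uv(3) by blast
    have reach: "(?r, w) \<in> (adj (E - {e}))\<^sup>* \<Longrightarrow> (?r, w) \<in> (adj (E - {f}))\<^sup>*" for w
    proof (induction rule: rtrancl_induct)
      case (step s t)
      have "v \<noteq> s" "v \<noteq> t" using uv(3) step.hyps by (auto simp: hanging_def intro: rtrancl_into_rtrancl)
      then have "(s, t) \<in> adj (E - {f})" using step.hyps(2) f by (auto simp: adj_def)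
      with step.IH show ?case by (rule rtrancl_into_rtrancl)
    qed simp
    have "(?r, u) \<in> (adj (E - {f}))\<^sup>*" using uv(2) reach by (simp add: hanging_def)
    moreover have "(u, v) \<in> adj (E - {f})" using e f uv by (auto simp: adj_def)
    ultimately have "v \<notin> hanging f" by (auto simp: hanging_def intro: rtrancl_into_rtrancl)
    moreover have "hanging f \<subseteq> hanging e" using reach by (auto simp: hanging_def)
    ultimately have "hanging f \<subset> hanging e" using uv(3) by blast
    then show "card (hanging f) < card (hanging e)" by (simp add: psubset_card_mono)
  qed
  then show ?thesis using uv(1) by blast
qed

end

section \<open>Orders in which the trees are light\<close>

lemma cycle_edges_image: "cycle_edges p = (\<lambda>i. {p ! i, p ! (Suc i mod length p)}) ` {..<length p}"
  by (auto simp: cycle_edges_def)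

lemma cycle_edges_3: "cycle_edges [a, b, c] = {{a, b}, {b, c}, {c, a}}"
proof -
  have "{..<length [a, b, c]} = {0, Suc 0, Suc (Suc 0)}" by auto
  then show ?thesis unfolding cycle_edges_image by simp
qed

lemma cycle_edges_4: "cycle_edges [a, b, c, d] = {{a, b}, {b, c}, {c, d}, {d, a}}"
proof -
  have "{..<length [a, b, c, d]} = {0, Suc 0, Suc (Suc 0), Suc (Suc (Suc 0))}" by auto
  then show ?thesis unfolding cycle_edges_image by simp
qed

lemma cycle_edges_5: "cycle_edges [a, b, c, d, e] = {{a, b}, {b, c}, {c, d}, {d, e}, {e, a}}"
proof -
  have "{..<length [a, b, c, d, e]} = {0, Suc 0, Suc (Suc 0), Suc (Suc (Suc 0)), Suc (Suc (Suc (Suc 0)))}" by auto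
  then show ?thesis unfolding cycle_edges_image by simp
qed

lemma cycle_edges_6:
  "cycle_edges [a, b, c, d, e, f] = {{a, b}, {b, c}, {c, d}, {d, e}, {e, f}, {f, a}}"
proof -
  have "{..<length [a, b, c, d, e, f]} = {0, Suc 0, Suc (Suc 0), Suc (Suc (Suc 0)), Suc (Suc (Suc (Suc 0))), Suc (Suc (Suc (Suc (Suc 0))))}" by auto
  then show ?thesis unfolding cycle_edges_image by simp
qed

text \<open>An edge with this property cannot be the middle edge of a conflict: at the endpoint \<open>v\<close> the
  middle edge would have to meet a heavier one.\<close>

definition descends :: "'v set set \<Rightarrow> ('v set \<Rightarrow> nat) \<Rightarrow> 'v set \<Rightarrow> bool" where
  "descends E g e \<longleftrightarrow> (\<exists>v\<in>e. \<forall>f\<in>E. v \<in> f \<and> f \<noteq> e \<longrightarrow> g f < g e)"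

context unicyclic_graph
begin

lemma tree_first_order:
  fixes s :: "'v set \<Rightarrow> nat"
  obtains g :: "'v set \<Rightarrow> nat" where "inj_on g E"
    "\<And>e. e \<in> E - C \<Longrightarrow> descends E g e"
    "\<And>e f. e \<in> E - C \<Longrightarrow> f \<in> C \<Longrightarrow> g e < g f"
    "\<And>e f. e \<in> C \<Longrightarrow> f \<in> C \<Longrightarrow> s e < s f \<Longrightarrow> g e < g f"
proof -
  define t where "t e = (if e \<in> C then Suc (card (UNIV :: 'v set)) + s e else card (hanging e))" for e
  have "finite E" by simp
  then obtain g :: "'v set \<Rightarrow> nat" where g: "inj_on g E"
    "\<And>e f. e \<in> E \<Longrightarrow> f \<in> E \<Longrightarrow> t e < t f \<Longrightarrow> g e < g f"
    by (rule injective_refinement[of E t]) blast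
  have below: "g e < g f" if "e \<in> E - C" "f \<in> C" for e f
  proof (rule g(2))
    have "card (hanging e) \<le> card (UNIV :: 'v set)" by (simp add: card_mono)
    then show "t e < t f" using that by (simp add: t_def)
  qed (use that C_subset in auto)
  have desc: "descends E g e" if e: "e \<in> E - C" for e
  proof -
    obtain v where v: "v \<in> e"
      "\<And>f. f \<in> E \<Longrightarrow> v \<in> f \<Longrightarrow> f \<noteq> e \<Longrightarrow> f \<notin> C \<and> card (hanging f) < card (hanging e)"
      using hanging_decreases[OF e] by blast
    have "g f < g e" if f: "f \<in> E" "v \<in> f" "f \<noteq> e" for f
      using g(2)[of f e] v(2)[OF f] e f(1) by (simp add: t_def)
    then show ?thesis using v(1) unfolding descends_def by blast
  qed
  have "g e < g f" if "e \<in> C" "f \<in> C" "s e < s f" for e f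
    using g(2)[of e f] that C_subset by (auto simp: t_def)
  then show thesis using that g(1) below desc by blast
qed

text \<open>The middle edge does not descend, so it is a cycle edge; the two end edges are heavier than it and
  are therefore not tree edges either.\<close>

lemma conflict_within_cycle:
  assumes inj: "inj_on g E" and desc: "\<And>e. e \<in> E - C \<Longrightarrow> descends E g e"
    and below: "\<And>e f. e \<in> E - C \<Longrightarrow> f \<in> C \<Longrightarrow> g e < g f"
    and con: "conflict E g \<tau> a b"
  obtains x y z w where "{x, y} \<in> C" "{x, z} \<in> C" "{y, w} \<in> C" "a = {x, z}" "b = {y, w}"
    "z \<notin> {x, y}" "w \<notin> {x, y}" "\<forall>e\<in>\<tau>. x \<in> e \<or> y \<in> e \<longrightarrow> e = {x, y}"
    "z \<in> \<Union>\<tau>" "w \<in> \<Union>\<tau>" "\<not> descends E g {x, y}"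
proof -
  obtain x y z w where c: "{x, y} \<in> \<tau>" "a = {x, z}" "b = {y, w}" "z \<notin> {x, y}" "w \<notin> {x, y}"
    "\<forall>e\<in>\<tau>. x \<in> e \<or> y \<in> e \<longrightarrow> e = {x, y}" "z \<in> \<Union>\<tau>" "w \<in> \<Union>\<tau>"
    "g {x, y} < g a" "g {x, y} < g b"
    by (rule conflict_middle_edge[OF simple inj con])
  have E: "{x, y} \<in> E" "a \<in> E" "b \<in> E" using con c(1) by (auto simp: conflict_def)
  have nd: "\<not> descends E g {x, y}"
  proof
    assume "descends E g {x, y}"
    then obtain v where v: "v \<in> {x, y}" "\<And>f. f \<in> E \<Longrightarrow> v \<in> f \<Longrightarrow> f \<noteq> {x, y} \<Longrightarrow> g f < g {x, y}"
      unfolding descends_def by blast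
    have "a \<noteq> {x, y}" "b \<noteq> {x, y}" using c(9,10) by auto
    then have "v \<in> a \<Longrightarrow> g a < g {x, y}" "v \<in> b \<Longrightarrow> g b < g {x, y}" using v(2) E by blast+
    moreover have "v \<in> a \<or> v \<in> b" using v(1) c(2,3) by blast
    ultimately show False using c(9,10) by linarith
  qed
  then have cC: "{x, y} \<in> C" using desc E(1) by blast
  have "a \<in> C" "b \<in> C" using below[OF _ cC] E(2,3) c(9,10) by (meson DiffI less_asym)+
  then show thesis using that c cC nd by blast
qed

lemma descends_cycle_edge:
  assumes below: "\<And>e f. e \<in> E - C \<Longrightarrow> f \<in> C \<Longrightarrow> g e < g f"
    and "e \<in> C" "v \<in> e" and cycle: "\<forall>f\<in>C. v \<in> f \<and> f \<noteq> e \<longrightarrow> g f < g e"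
  shows "descends E g e"
  unfolding descends_def
proof (intro bexI ballI impI)
  fix f assume "f \<in> E" "v \<in> f \<and> f \<noteq> e"
  then show "g f < g e" using below[of f e] cycle \<open>e \<in> C\<close> by (cases "f \<in> C") auto
qed fact

section \<open>Friendly orders for short cycles\<close>

text \<open>With \<open>{x, y}\<close> the lightest cycle edge it is the only candidate for a middle edge. Its neighbours
  on the cycle meet in \<open>v\<close>, which would have to be covered by an edge avoiding \<open>x\<close> and
  \<open>y\<close>; but \<open>v\<close> has degree \<open>2\<close>.\<close>

lemma triangle_friendly:
  assumes p: "p = [v, x, y]" and deg: "degree E v = 2"
  shows "\<exists>g. inj_on g E \<and> (\<forall>\<tau> a b. \<not> conflict E g \<tau> a b)"
proof -
  have C: "C = {{v, x}, {x, y}, {y, v}}" unfolding p by (rule cycle_edges_3)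
  have dist: "v \<noteq> x" "v \<noteq> y" "x \<noteq> y" using distinct_p p by auto
  define s :: "'v set \<Rightarrow> nat" where "s e = (if e = {x, y} then 0 else if e = {y, v} then 1 else 2)" for e
  obtain g where inj: "inj_on g E" and desc: "\<And>e. e \<in> E - C \<Longrightarrow> descends E g e"
    and below: "\<And>e f. e \<in> E - C \<Longrightarrow> f \<in> C \<Longrightarrow> g e < g f"
    and gs: "\<And>e f. e \<in> C \<Longrightarrow> f \<in> C \<Longrightarrow> s e < s f \<Longrightarrow> g e < g f"
    using tree_first_order[of s] by metis
  have less: "g {x, y} < g {y, v}" "g {x, y} < g {v, x}"
    by (rule gs; use dist C in \<open>force simp: s_def doubleton_eq_iff\<close>)+
  have d1: "descends E g {y, v}"
    by (rule descends_cycle_edge[OF below, where v = y]) (use less dist in \<open>auto simp: C\<close>)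
  have d2: "descends E g {v, x}"
    by (rule descends_cycle_edge[OF below, where v = x]) (use less dist in \<open>auto simp: C\<close>)
  have "\<not> conflict E g \<tau> a b" for \<tau> a b
  proof
    assume con: "conflict E g \<tau> a b"
    obtain x' y' z w where c: "{x', y'} \<in> C" "{x', z} \<in> C" "{y', w} \<in> C"
      "a = {x', z}" "b = {y', w}" "z \<notin> {x', y'}" "w \<notin> {x', y'}"
      and only: "\<forall>e\<in>\<tau>. x' \<in> e \<or> y' \<in> e \<longrightarrow> e = {x', y'}"
      and cov: "z \<in> \<Union>\<tau>" "w \<in> \<Union>\<tau>" and nd: "\<not> descends E g {x', y'}"
      by (rule conflict_within_cycle[OF inj desc below con])
    have "e = {x, y} \<or> descends E g e" if "e \<in> C" for e
      using that d1 d2 unfolding C by (auto simp only: insert_iff empty_iff simp_thms)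
    with c(1) nd have xy: "{x', y'} = {x, y}" by metis
    then have "z = v" using cycle_edge_subset[OF c(2)] c(6) p by auto
    then obtain e where e: "e \<in> \<tau>" "v \<in> e" using cov(1) by blast
    then have "e \<in> C" using con degree_eq_2_iff[of v] deg p by (auto simp: conflict_def)
    then have "x \<in> e \<or> y \<in> e"
      unfolding C by (auto simp only: insert_iff empty_iff simp_thms)
    then have "x' \<in> e \<or> y' \<in> e" using xy by (auto simp: doubleton_eq_iff)
    then have "e = {x, y}" using only e(1) xy by metis
    then show False using e(2) dist by simp
  qed
  then show ?thesis using inj by blast
qed

text \<open>The weights increase around the cycle from \<open>{x, s}\<close> over \<open>{s, t}\<close>, \<open>{t, y}\<close> and
  \<open>{y, v}\<close> to \<open>{v, x}\<close>, so that only \<open>{x, s}\<close> can be a middle edge. Then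
  \<open>v\<close> is covered by \<open>{y, v}\<close>, and minimality of the bridge \<open>{v, x}\<close> implies that
  no other edge of \<open>\<tau>\<close> covers \<open>y\<close>. Hence \<open>{t, y}\<close> is a gap. It is a true one: a
  lighter new bridge would be a tree edge at \<open>t\<close>, which would already be a bridge of
  \<open>insert {s, t} \<tau>\<close> and lighter than \<open>{s, t}\<close>.\<close>

lemma pentagon_friendly:
  assumes p: "p = [v, x, s, t, y]" and deg: "degree E v = 2"
  shows "\<exists>g. inj_on g E \<and> (\<forall>\<tau> a b. \<not> conflict E g \<tau> a b)"
proof -
  have C: "C = {{v, x}, {x, s}, {s, t}, {t, y}, {y, v}}" unfolding p by (rule cycle_edges_5)
  have dist: "v \<noteq> x" "v \<noteq> s" "v \<noteq> t" "v \<noteq> y" "x \<noteq> s" "x \<noteq> t" "x \<noteq> y" "s \<noteq> t" "s \<noteq> y" "t \<noteq> y"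
    using distinct_p p by auto
  define r :: "'v set \<Rightarrow> nat" where "r e = (if e = {x, s} then 0 else if e = {s, t} then 1
    else if e = {t, y} then 2 else if e = {y, v} then 3 else 4)" for e
  have r: "r {x, s} = 0" "r {s, t} = 1" "r {t, y} = 2" "r {y, v} = 3" "r {v, x} = 4"
    using dist by (auto simp: r_def doubleton_eq_iff)
  obtain g where inj: "inj_on g E" and desc: "\<And>e. e \<in> E - C \<Longrightarrow> descends E g e"
    and below: "\<And>e f. e \<in> E - C \<Longrightarrow> f \<in> C \<Longrightarrow> g e < g f"
    and gs: "\<And>e f. e \<in> C \<Longrightarrow> f \<in> C \<Longrightarrow> r e < r f \<Longrightarrow> g e < g f"
    using tree_first_order[of r] by metis
  have less: "g {x, s} < g {s, t}" "g {s, t} < g {t, y}" "g {t, y} < g {y, v}" "g {y, v} < g {v, x}"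
    "g {x, s} < g {v, x}"
    by (rule gs; simp add: C r)+
  have d: "descends E g {s, t}" "descends E g {t, y}" "descends E g {y, v}" "descends E g {v, x}"
  proof -
    show "descends E g {s, t}"
      by (rule descends_cycle_edge[OF below, where v = s]) (use less dist in \<open>auto simp: C\<close>)
    show "descends E g {t, y}"
      by (rule descends_cycle_edge[OF below, where v = t]) (use less dist in \<open>auto simp: C\<close>)
    show "descends E g {y, v}"
      by (rule descends_cycle_edge[OF below, where v = y]) (use less dist in \<open>auto simp: C\<close>)
    show "descends E g {v, x}"
      by (rule descends_cycle_edge[OF below, where v = x]) (use less dist in \<open>auto simp: C\<close>)
  qed
  have key: False
    if con: "conflict E g \<tau> {v, x} {s, t}" and only: "\<forall>e\<in>\<tau>. x \<in> e \<or> s \<in> e \<longrightarrow> e = {x, s}"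
      and cov: "v \<in> \<Union>\<tau>" "t \<in> \<Union>\<tau>" for \<tau>
  proof -
    have \<tau>: "\<tau> \<subseteq> E" "{v, x} \<notin> \<tau>" "{s, t} \<notin> \<tau>" and E: "{v, x} \<in> E"
      and crit: "critical E g (insert {v, x} \<tau>) {v, x}" "critical E g (insert {s, t} \<tau>) {s, t}"
      using con by (auto simp: conflict_def)
    obtain e where e: "e \<in> \<tau>" "v \<in> e" using cov by blast
    then have "e \<in> C" using \<tau> degree_eq_2_iff[of v] deg p by auto
    then have yv: "{y, v} \<in> \<tau>" using e \<tau> C dist by auto
    have y_only: "e = {y, v}" if "e \<in> \<tau>" "y \<in> e" for e
    proof (rule ccontr)
      assume "e \<noteq> {y, v}"
      then have "redundant (insert {v, x} \<tau>) {y, v}"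
        using that yv dist unfolding redundant_def by (auto simp: doubleton_eq_iff)
      from critical_least[OF crit(1) this] show False using less by simp
    qed
    have ty: "{t, y} \<notin> \<tau>" using y_only dist by (auto simp: doubleton_eq_iff)
    have "{t, y} \<in> E" using C C_subset by blast
    moreover have "{t, y} \<notin> insert {v, x} \<tau>" using ty dist by (auto simp: doubleton_eq_iff)
    moreover have "{t, y} \<subseteq> \<Union>(insert {v, x} \<tau>)" using cov yv by auto
    moreover have "g {t, y} < g {v, x}" using less by simp
    ultimately obtain f where f: "redundant (insert {t, y} (insert {v, x} \<tau>)) f" "g f < g {t, y}"
      "\<not> redundant (insert {v, x} \<tau>) f" using critical_gapE[OF crit(1)] by metis
    have ne: "f \<noteq> {t, y}" "f \<noteq> {v, x}" "f \<noteq> {y, v}" using f(2) less by auto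
    then have f\<tau>: "f \<in> \<tau>" using f(1) by (simp add: redundant_def)
    have yf: "y \<notin> f" using y_only f\<tau> ne by blast
    have f_cov: "f \<subseteq> {t, y} \<union> \<Union>(insert {v, x} \<tau> - {f})" using f(1) by (auto simp: redundant_def)
    have "\<not> f \<subseteq> \<Union>(insert {v, x} \<tau> - {f})" using f(3) f\<tau> by (simp add: redundant_def)
    then have tf: "t \<in> f" using f_cov yf by blast
    have "f \<notin> C" using tf ne \<tau> f\<tau> dist unfolding C by auto
    have "f \<in> E" using f\<tau> \<tau> by blast
    \<comment> \<open>The endpoint \<open>t\<close> of \<open>f\<close> is covered by \<open>{s, t}\<close>, the other one lies outside the cycle and is covered by \<open>\<tau>\<close>.\<close>
    have "u \<in> \<Union>(insert {s, t} \<tau> - {f})" if u: "u \<in> f" for u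
    proof (cases "u = t")
      case True
      moreover have "f \<noteq> {s, t}" using f\<tau> \<tau> by blast
      ultimately show ?thesis by blast
    next
      case False
      obtain u' where u': "f = {t, u'}" using edge_other_endpoint[OF \<open>f \<in> E\<close> tf] by metis
      then have uu: "u = u'" using u False by blast
      have "u \<notin> set p"
      proof
        assume "u \<in> set p"
        then have "f \<subseteq> set p" using u' uu p by auto
        then show False using no_chord \<open>f \<in> E\<close> \<open>f \<notin> C\<close> by blast
      qed
      then have "u \<noteq> y" "u \<notin> {v, x}" using p by auto
      then have "u \<in> \<Union>(\<tau> - {f})" using f_cov u False by blast
      then show ?thesis by blast
    qed
    then have "redundant (insert {s, t} \<tau>) f" using f\<tau> unfolding redundant_def by blast
    moreover have "g f < g {s, t}" using below[of f "{s, t}"] \<open>f \<in> E\<close> \<open>f \<notin> C\<close> C by blast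
    ultimately show False using critical_least[OF crit(2)] by fastforce
  qed
  have "\<not> conflict E g \<tau> a b" for \<tau> a b
  proof
    assume con: "conflict E g \<tau> a b"
    obtain x' y' z w where c: "{x', y'} \<in> C" "{x', z} \<in> C" "{y', w} \<in> C" "a = {x', z}" "b = {y', w}"
      "z \<notin> {x', y'}" "w \<notin> {x', y'}" "\<forall>e\<in>\<tau>. x' \<in> e \<or> y' \<in> e \<longrightarrow> e = {x', y'}"
      "z \<in> \<Union>\<tau>" "w \<in> \<Union>\<tau>" "\<not> descends E g {x', y'}"
      by (rule conflict_within_cycle[OF inj desc below con])
    have "e = {x, s} \<or> descends E g e" if "e \<in> C" for e
      using that d unfolding C by (auto simp only: insert_iff empty_iff simp_thms)
    with c(1,11) have "{x', y'} = {x, s}" by metis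
    then consider "x' = x" "y' = s" | "x' = s" "y' = x" by (auto simp: doubleton_eq_iff)
    then show False
    proof cases
      case 1
      have zw: "z = v" "w = t"
        using c(2,3,6,7) dist unfolding 1 C by (auto simp: doubleton_eq_iff)
      have "conflict E g \<tau> {v, x} {s, t}"
        using con unfolding c(4,5) 1 zw insert_commute[of x v "{}"] .
      from key[OF this] show False using c(8,9,10) unfolding 1 zw by blast
    next
      case 2
      have zw: "z = t" "w = v"
        using c(2,3,6,7) dist unfolding 2 C by (auto simp: doubleton_eq_iff)
      have "conflict E g \<tau> {v, x} {s, t}"
        using conflict_sym[OF con] unfolding c(4,5) 2 zw insert_commute[of x v "{}"] .
      from key[OF this] show False using c(8,9,10) unfolding 2 zw by blast
    qed
  qed
  then show ?thesis using inj by blast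
qed

text \<open>Two opposite edges away from \<open>v0\<close> and \<open>v3\<close> are made lightest. If one of them is the middle
  edge of a conflict, \<open>v0\<close> and \<open>v3\<close> are the far ends of its neighbours. Having degree \<open>2\<close>,
  they are covered by the cycle edges adjacent to the other light edge, which contradicts
  \<open>no_covered_light_edge\<close>.\<close>

lemma hexagon_friendly:
  assumes p: "p = [v0, v1, v2, v3, v4, v5]" and deg: "degree E v0 = 2" "degree E v3 = 2"
  shows "\<exists>g. inj_on g E \<and> (\<forall>\<tau> a b. \<not> conflict E g \<tau> a b)"
proof -
  have C: "C = {{v0, v1}, {v1, v2}, {v2, v3}, {v3, v4}, {v4, v5}, {v5, v0}}"
    unfolding p by (rule cycle_edges_6)
  have dist: "distinct [v0, v1, v2, v3, v4, v5]" using distinct_p p by simp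
  define r :: "'v set \<Rightarrow> nat" where
    "r e = (if e = {v1, v2} then 0 else if e = {v4, v5} then 1 else 2)" for e
  have r: "r {v1, v2} = 0" "r {v4, v5} = 1" "r {v0, v1} = 2" "r {v2, v3} = 2" "r {v3, v4} = 2"
    "r {v5, v0} = 2"
    using dist by (auto simp: r_def doubleton_eq_iff)
  obtain g where inj: "inj_on g E" and desc: "\<And>e. e \<in> E - C \<Longrightarrow> descends E g e"
    and below: "\<And>e f. e \<in> E - C \<Longrightarrow> f \<in> C \<Longrightarrow> g e < g f"
    and gs: "\<And>e f. e \<in> C \<Longrightarrow> f \<in> C \<Longrightarrow> r e < r f \<Longrightarrow> g e < g f"
    using tree_first_order[of r] by metis
  have less: "g {v1, v2} < g {v0, v1}" "g {v1, v2} < g {v2, v3}" "g {v1, v2} < g {v3, v4}"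
    "g {v1, v2} < g {v5, v0}" "g {v4, v5} < g {v0, v1}" "g {v4, v5} < g {v2, v3}"
    "g {v4, v5} < g {v3, v4}" "g {v4, v5} < g {v5, v0}"
    by (rule gs; simp add: C r)+
  have d: "descends E g {v0, v1}" "descends E g {v2, v3}" "descends E g {v3, v4}"
    "descends E g {v5, v0}"
  proof -
    show "descends E g {v0, v1}"
      by (rule descends_cycle_edge[OF below, where v = v1]) (use less dist in \<open>auto simp: C\<close>)
    show "descends E g {v2, v3}"
      by (rule descends_cycle_edge[OF below, where v = v2]) (use less dist in \<open>auto simp: C\<close>)
    show "descends E g {v3, v4}"
      by (rule descends_cycle_edge[OF below, where v = v4]) (use less dist in \<open>auto simp: C\<close>)
    show "descends E g {v5, v0}"
      by (rule descends_cycle_edge[OF below, where v = v5]) (use less dist in \<open>auto simp: C\<close>)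
  qed
  have cov0: "{v0, v1} \<in> \<tau> \<or> {v5, v0} \<in> \<tau>" if \<tau>: "v0 \<in> \<Union>\<tau>" "\<tau> \<subseteq> E" for \<tau>
  proof -
    obtain e where e: "e \<in> \<tau>" "v0 \<in> e" using \<tau>(1) by blast
    then have "e \<in> C" using \<tau>(2) degree_eq_2_iff[of v0] deg p by auto
    then show ?thesis using e C dist by auto
  qed
  have cov3: "{v2, v3} \<in> \<tau> \<or> {v3, v4} \<in> \<tau>" if \<tau>: "v3 \<in> \<Union>\<tau>" "\<tau> \<subseteq> E" for \<tau>
  proof -
    obtain e where e: "e \<in> \<tau>" "v3 \<in> e" using \<tau>(1) by blast
    then have "e \<in> C" using \<tau>(2) degree_eq_2_iff[of v3] deg p by auto
    then show ?thesis using e C dist by auto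
  qed
  have key1: False if con: "conflict E g \<tau> {v0, v1} {v2, v3}" and "v0 \<in> \<Union>\<tau>" "v3 \<in> \<Union>\<tau>" for \<tau>
  proof (rule no_covered_light_edge[of E g "{v0, v1}" \<tau> "{v4, v5}" "{v3, v4}" "{v5, v0}"])
    show "critical E g (insert {v0, v1} \<tau>) {v0, v1}" using con by (simp add: conflict_def)
    show "{v3, v4} \<in> \<tau>" "{v5, v0} \<in> \<tau>"
      using cov0[of \<tau>] cov3[of \<tau>] that by (auto simp: conflict_def)
    show "{v4, v5} \<in> E" using C C_subset by blast
  qed (use less dist in \<open>auto simp: doubleton_eq_iff\<close>)
  have key2: False if con: "conflict E g \<tau> {v3, v4} {v5, v0}" and "v0 \<in> \<Union>\<tau>" "v3 \<in> \<Union>\<tau>" for \<tau>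
  proof (rule no_covered_light_edge[of E g "{v3, v4}" \<tau> "{v1, v2}" "{v0, v1}" "{v2, v3}"])
    show "critical E g (insert {v3, v4} \<tau>) {v3, v4}" using con by (simp add: conflict_def)
    show "{v0, v1} \<in> \<tau>" "{v2, v3} \<in> \<tau>"
      using cov0[of \<tau>] cov3[of \<tau>] that by (auto simp: conflict_def)
    show "{v1, v2} \<in> E" using C C_subset by blast
  qed (use less dist in \<open>auto simp: doubleton_eq_iff\<close>)
  have "\<not> conflict E g \<tau> a b" for \<tau> a b
  proof
    assume con: "conflict E g \<tau> a b"
    obtain x y z w where c: "{x, y} \<in> C" "{x, z} \<in> C" "{y, w} \<in> C" "a = {x, z}" "b = {y, w}"
      "z \<notin> {x, y}" "w \<notin> {x, y}"
      and "\<forall>e\<in>\<tau>. x \<in> e \<or> y \<in> e \<longrightarrow> e = {x, y}"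
      and cov: "z \<in> \<Union>\<tau>" "w \<in> \<Union>\<tau>" and nd: "\<not> descends E g {x, y}"
      by (rule conflict_within_cycle[OF inj desc below con])
    have "e = {v1, v2} \<or> e = {v4, v5} \<or> descends E g e" if "e \<in> C" for e
      using that d unfolding C by (auto simp only: insert_iff empty_iff simp_thms)
    with c(1) nd have "{x, y} = {v1, v2} \<or> {x, y} = {v4, v5}" by metis
    then consider "x = v1" "y = v2" | "x = v2" "y = v1" | "x = v4" "y = v5" | "x = v5" "y = v4"
      by (auto simp: doubleton_eq_iff)
    then show False
    proof cases
      case 1
      have zw: "z = v0" "w = v3"
        using c(2,3,6,7) dist unfolding 1 C by (auto simp: doubleton_eq_iff)
      have "conflict E g \<tau> {v0, v1} {v2, v3}"
        using con unfolding c(4,5) 1 zw insert_commute[of v1 v0 "{}"] .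
      from key1[OF this] show False using cov unfolding zw by blast
    next
      case 2
      have zw: "z = v3" "w = v0"
        using c(2,3,6,7) dist unfolding 2 C by (auto simp: doubleton_eq_iff)
      have "conflict E g \<tau> {v0, v1} {v2, v3}"
        using conflict_sym[OF con] unfolding c(4,5) 2 zw insert_commute[of v1 v0 "{}"] .
      from key1[OF this] show False using cov unfolding zw by blast
    next
      case 3
      have zw: "z = v3" "w = v0"
        using c(2,3,6,7) dist unfolding 3 C by (auto simp: doubleton_eq_iff)
      have "conflict E g \<tau> {v3, v4} {v5, v0}"
        using con unfolding c(4,5) 3 zw insert_commute[of v4 v3 "{}"] .
      from key2[OF this] show False using cov unfolding zw by blast
    next
      case 4
      have zw: "z = v0" "w = v3"
        using c(2,3,6,7) dist unfolding 4 C by (auto simp: doubleton_eq_iff)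
      have "conflict E g \<tau> {v3, v4} {v5, v0}"
        using conflict_sym[OF con] unfolding c(4,5) 4 zw insert_commute[of v4 v3 "{}"] .
      from key2[OF this] show False using cov unfolding zw by blast
    qed
  qed
  then show ?thesis using inj by blast
qed

section \<open>Unavoidable conflicts\<close>

text \<open>Used to verify that a configuration is induced: the two attached vertices bring in no edges
  besides their own. Taking \<open>q = r\<close> covers the case of a single attached vertex.\<close>

lemma edges_with_two_attached:
  assumes uq: "{u, q} \<in> E" "u \<in> set p" "q \<notin> set p" and vr: "{v, r} \<in> E" "v \<in> set p" "r \<notin> set p"
    and e: "e \<in> E" "e \<subseteq> set p \<union> {q, r}"
  shows "e \<in> C \<or> e = {u, q} \<or> e = {v, r}"
proof -
  have *: "e = {u, q}" if q: "q \<in> e" and uq: "{u, q} \<in> E" "u \<in> set p" "q \<notin> set p"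
    and vr: "{v, r} \<in> E" "v \<in> set p" "r \<notin> set p" and e: "e \<subseteq> set p \<union> {q, r}" for u q v r
  proof -
    obtain t where t: "e = {q, t}" "t \<noteq> q" using edge_other_endpoint[OF \<open>e \<in> E\<close> q] by metis
    have "t \<noteq> r" using attached_vertices_nonadjacent[OF uq(1) vr(1) uq(2) vr(2) uq(3) vr(3)] t \<open>e \<in> E\<close>
      by blast
    then have "t \<in> set p" using e t by auto
    moreover have "{t, q} \<in> E" using t \<open>e \<in> E\<close> by (simp add: insert_commute)
    ultimately have "t = u" using attachment_unique uq by blast
    then show ?thesis using t by (simp add: insert_commute)
  qed
  show ?thesis
  proof (cases "q \<in> e \<or> r \<in> e")
    case True
    moreover have "e \<subseteq> set p \<union> {r, q}" using e(2) by blast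
    ultimately show ?thesis using *[OF _ uq vr e(2)] *[OF _ vr uq] by blast
  next
    case False
    then have "e \<subseteq> set p" using e(2) by blast
    then show ?thesis using no_chord e(1) by blast
  qed
qed

text \<open>In the next lemmas the cycle is rotated so that its lightest edge comes first; only the two edges
  covering its neighbours have to be chosen. Here both are the edge leaving the triangle at
  \<open>z\<close>.\<close>

lemma triangle_conflict:
  assumes p: "p = [x, y, z]" and deg: "degree E z \<noteq> 2"
    and head_least: "\<And>e. e \<in> C \<Longrightarrow> e \<noteq> {p ! 0, p ! 1} \<Longrightarrow> g {p ! 0, p ! 1} < g e"
  shows "\<exists>\<tau> a b. conflict E g \<tau> a b"
proof -
  have least: "g {x, y} < g e" if "e \<in> C" "e \<noteq> {x, y}" for e
    using head_least[of e] that p by simp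
  have C: "C = {{x, y}, {y, z}, {x, z}}"
    unfolding p cycle_edges_3 insert_commute[of z x "{}"] ..
  have dist: "distinct [x, y, z]" using distinct_p p by simp
  obtain q where q: "{z, q} \<in> E" "q \<notin> set p" using pendant_edge[of z] deg p by auto
  have z: "z \<in> set p" using p by simp
  have "conflict E g {{x, y}, {z, q}, {z, q}} {x, z} {y, z}"
  proof (rule conflict_of_local_minimum[OF simple])
    show "{x, y} \<in> E" "{x, z} \<in> E" "{y, z} \<in> E" "{z, q} \<in> E" "{z, q} \<in> E"
      using C_subset[unfolded C] q by blast+
    show "e \<in> {{x, y}, {x, z}, {y, z}, {z, q}, {z, q}}"
      if "e \<in> E" "e \<subseteq> {x, y} \<union> {z, q} \<union> {z, q}" for e
    proof -
      have "e \<subseteq> set p \<union> {q, q}" using that(2) p by auto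
      from edges_with_two_attached[OF q(1) z q(2) q(1) z q(2) that(1) this]
      show ?thesis unfolding C by (auto simp only: insert_iff empty_iff simp_thms)
    qed
    show "g {x, y} < g {x, z}" "g {x, y} < g {y, z}"
      by (rule least; use dist in \<open>force simp: C doubleton_eq_iff\<close>)+
  qed (use dist q p in auto)
  then show ?thesis by blast
qed

text \<open>The opposite edge covers both neighbours.\<close>

lemma square_conflict:
  assumes p: "p = [x, y, w, z]"
    and head_least: "\<And>e. e \<in> C \<Longrightarrow> e \<noteq> {p ! 0, p ! 1} \<Longrightarrow> g {p ! 0, p ! 1} < g e"
  shows "\<exists>\<tau> a b. conflict E g \<tau> a b"
proof -
  have least: "g {x, y} < g e" if "e \<in> C" "e \<noteq> {x, y}" for e
    using head_least[of e] that p by simp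
  have C: "C = {{x, y}, {y, w}, {w, z}, {x, z}}"
    unfolding p cycle_edges_4 insert_commute[of z x "{}"] ..
  have dist: "distinct [x, y, w, z]" using distinct_p p by simp
  have "conflict E g {{x, y}, {w, z}, {w, z}} {x, z} {y, w}"
  proof (rule conflict_of_local_minimum[OF simple])
    show "{x, y} \<in> E" "{x, z} \<in> E" "{y, w} \<in> E" "{w, z} \<in> E" "{w, z} \<in> E"
      using C_subset[unfolded C] by blast+
    show "e \<in> {{x, y}, {x, z}, {y, w}, {w, z}, {w, z}}"
      if "e \<in> E" "e \<subseteq> {x, y} \<union> {w, z} \<union> {w, z}" for e
    proof -
      have "e \<subseteq> set p" using that(2) p by auto
      from no_chord[OF that(1) this] show ?thesis unfolding C by (auto simp only: insert_iff empty_iff simp_thms)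
    qed
    show "g {x, y} < g {x, z}" "g {x, y} < g {y, w}"
      by (rule least; use dist in \<open>force simp: C doubleton_eq_iff\<close>)+
  qed (use dist in auto)
  then show ?thesis by blast
qed

text \<open>The edges \<open>{w, m}\<close> and \<open>{m, z}\<close> meet, so both covering edges leave the cycle.\<close>

lemma pentagon_conflict:
  assumes p: "p = [x, y, w, m, z]" and deg: "degree E w \<noteq> 2" "degree E z \<noteq> 2"
    and head_least: "\<And>e. e \<in> C \<Longrightarrow> e \<noteq> {p ! 0, p ! 1} \<Longrightarrow> g {p ! 0, p ! 1} < g e"
  shows "\<exists>\<tau> a b. conflict E g \<tau> a b"
proof -
  have least: "g {x, y} < g e" if "e \<in> C" "e \<noteq> {x, y}" for e
    using head_least[of e] that p by simp
  have C: "C = {{x, y}, {y, w}, {w, m}, {m, z}, {x, z}}"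
    unfolding p cycle_edges_5 insert_commute[of z x "{}"] ..
  have dist: "distinct [x, y, w, m, z]" using distinct_p p by simp
  have mem: "w \<in> set p" "z \<in> set p" using p by simp_all
  obtain q where q: "{z, q} \<in> E" "q \<notin> set p" using pendant_edge[of z] deg mem by auto
  obtain r where r: "{w, r} \<in> E" "r \<notin> set p" using pendant_edge[of w] deg mem by auto
  have qr: "q \<noteq> r" using attachment_unique[OF q(1) _ mem(2,1) q(2)] r dist by auto
  have "conflict E g {{x, y}, {z, q}, {w, r}} {x, z} {y, w}"
  proof (rule conflict_of_local_minimum[OF simple])
    show "{x, y} \<in> E" "{x, z} \<in> E" "{y, w} \<in> E" "{z, q} \<in> E" "{w, r} \<in> E"
      using C_subset[unfolded C] q r by blast+
    show "e \<in> {{x, y}, {x, z}, {y, w}, {z, q}, {w, r}}"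
      if "e \<in> E" "e \<subseteq> {x, y} \<union> {z, q} \<union> {w, r}" for e
    proof -
      have "e \<subseteq> set p \<union> {q, r}" using that(2) p by auto
      from edges_with_two_attached[OF q(1) mem(2) q(2) r(1) mem(1) r(2) that(1) this]
      consider "e \<in> C" | "e = {z, q}" | "e = {w, r}" by blast
      then show ?thesis
      proof cases
        case 1
        moreover have "m \<notin> e" using that(2) dist q(2) r(2) p by auto
        ultimately show ?thesis unfolding C by (auto simp only: insert_iff empty_iff simp_thms)
      qed auto
    qed
    show "g {x, y} < g {x, z}" "g {x, y} < g {y, w}"
      by (rule least; use dist in \<open>force simp: C doubleton_eq_iff\<close>)+
  qed (use dist q r qr p in auto)
  then show ?thesis by blast
qed

text \<open>Using \<open>{w, w'}\<close> together with \<open>{z, z'}\<close> would admit the additional gap \<open>{w', z'}\<close>.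
  One edge leaving the cycle suffices, since then only one of \<open>w'\<close> and \<open>z'\<close> is involved.\<close>

lemma hexagon_conflict:
  assumes p: "p = [x, y, w, w', z', z]" and deg: "degree E w \<noteq> 2 \<or> degree E z \<noteq> 2"
    and head_least: "\<And>e. e \<in> C \<Longrightarrow> e \<noteq> {p ! 0, p ! 1} \<Longrightarrow> g {p ! 0, p ! 1} < g e"
  shows "\<exists>\<tau> a b. conflict E g \<tau> a b"
proof -
  have least: "g {x, y} < g e" if "e \<in> C" "e \<noteq> {x, y}" for e
    using head_least[of e] that p by simp
  have C: "C = {{x, y}, {y, w}, {w, w'}, {w', z'}, {z, z'}, {x, z}}"
    unfolding p cycle_edges_6 insert_commute[of z x "{}"] insert_commute[of z' z "{}"] ..
  have dist: "distinct [x, y, w, w', z', z]" using distinct_p p by simp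
  have mem: "w \<in> set p" "z \<in> set p" using p by simp_all
  have E: "{x, y} \<in> E" "{x, z} \<in> E" "{y, w} \<in> E" "{w, w'} \<in> E" "{z, z'} \<in> E"
    using C_subset[unfolded C] by blast+
  have less: "g {x, y} < g {x, z}" "g {x, y} < g {y, w}"
    by (rule least; use dist in \<open>force simp: C doubleton_eq_iff\<close>)+
  from deg show ?thesis
  proof
    assume "degree E w \<noteq> 2"
    then obtain r where r: "{w, r} \<in> E" "r \<notin> set p" using pendant_edge[of w] mem by auto
    have "conflict E g {{x, y}, {z, z'}, {w, r}} {x, z} {y, w}"
    proof (rule conflict_of_local_minimum[OF simple E(1-3) E(5) r(1)])
      show "e \<in> {{x, y}, {x, z}, {y, w}, {z, z'}, {w, r}}"
        if "e \<in> E" "e \<subseteq> {x, y} \<union> {z, z'} \<union> {w, r}" for e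
      proof -
        have "e \<subseteq> set p \<union> {r, r}" using that(2) p by auto
        from edges_with_two_attached[OF r(1) mem(1) r(2) r(1) mem(1) r(2) that(1) this]
        consider "e \<in> C" | "e = {w, r}" by blast
        then show ?thesis
        proof cases
          case 1
          moreover have "w' \<notin> e" using that(2) dist r(2) p by auto
          ultimately show ?thesis unfolding C by (auto simp only: insert_iff empty_iff simp_thms)
        qed auto
      qed
    qed (use dist r p less in auto)
    then show ?thesis by blast
  next
    assume "degree E z \<noteq> 2"
    then obtain q where q: "{z, q} \<in> E" "q \<notin> set p" using pendant_edge[of z] mem by auto
    have "conflict E g {{x, y}, {z, q}, {w, w'}} {x, z} {y, w}"
    proof (rule conflict_of_local_minimum[OF simple E(1-3) q(1) E(4)])
      show "e \<in> {{x, y}, {x, z}, {y, w}, {z, q}, {w, w'}}"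
        if "e \<in> E" "e \<subseteq> {x, y} \<union> {z, q} \<union> {w, w'}" for e
      proof -
        have "e \<subseteq> set p \<union> {q, q}" using that(2) p by auto
        from edges_with_two_attached[OF q(1) mem(2) q(2) q(1) mem(2) q(2) that(1) this]
        consider "e \<in> C" | "e = {z, q}" by blast
        then show ?thesis
        proof cases
          case 1
          moreover have "z' \<notin> e" using that(2) dist q(2) p by auto
          ultimately show ?thesis unfolding C by (auto simp only: insert_iff empty_iff simp_thms)
        qed auto
      qed
    qed (use dist q p less in auto)
    then show ?thesis by blast
  qed
qed

text \<open>From length \<open>7\<close> on, the next cycle edges on both sides are neither adjacent nor joined by an
  edge.\<close>

lemma long_cycle_conflict:
  assumes n: "7 \<le> length p"
    and least: "\<And>e. e \<in> C \<Longrightarrow> e \<noteq> {p ! 0, p ! 1} \<Longrightarrow> g {p ! 0, p ! 1} < g e"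
  shows "\<exists>\<tau> a b. conflict E g \<tau> a b"
proof -
  define n where "n = length p"
  have n7: "7 \<le> n" using n by (simp add: n_def)
  have eq: "p ! i = p ! j \<longleftrightarrow> i = j" if "i < n" "j < n" for i j
    using nth_p_eq_iff that by (simp add: n_def)
  have step: "{p ! i, p ! Suc i} \<in> C" if "Suc i < n" for i
    unfolding cycle_edges_def using that by (auto simp: n_def intro!: exI[of _ i])
  have wrap: "{p ! 0, p ! (n - 1)} \<in> C" using cycle_edges_at_head by (auto simp: n_def insert_commute)
  let ?x = "p ! 0" and ?y = "p ! 1" and ?w = "p ! 2" and ?w' = "p ! 3"
    and ?z' = "p ! (n - 2)" and ?z = "p ! (n - 1)"
  have mem: "{?x, ?y} \<in> C" "{?y, ?w} \<in> C" "{?w, ?w'} \<in> C" "{?z, ?z'} \<in> C"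
    using step[of 0] step[of 1] step[of 2] step[of "n - 2"] n7
    by (simp_all add: eval_nat_numeral insert_commute Suc_diff_Suc)
  have "conflict E g {{?x, ?y}, {?z, ?z'}, {?w, ?w'}} {?x, ?z} {?y, ?w}"
  proof (rule conflict_of_local_minimum[OF simple])
    show "{?x, ?y} \<in> E" "{?x, ?z} \<in> E" "{?y, ?w} \<in> E" "{?z, ?z'} \<in> E" "{?w, ?w'} \<in> E"
      using mem wrap C_subset by blast+
    show "e \<in> {{?x, ?y}, {?x, ?z}, {?y, ?w}, {?z, ?z'}, {?w, ?w'}}"
      if "e \<in> E" "e \<subseteq> {?x, ?y} \<union> {?z, ?z'} \<union> {?w, ?w'}" for e
    proof -
      let ?J = "{0, 1, n - 1, n - 2, 2, 3}"
      have J: "j \<in> ?J" if "p ! j \<in> e" "j < n" for j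
      proof -
        have "\<exists>k\<in>?J. p ! j = p ! k" using that(1) \<open>e \<subseteq> _\<close> by blast
        moreover have "k < n" if "k \<in> ?J" for k using that n7 by auto
        ultimately show ?thesis using eq that(2) by blast
      qed
      have "p ! j \<in> set p" if "j < n" for j using that by (simp add: n_def)
      then have "{?x, ?y} \<union> {?z, ?z'} \<union> {?w, ?w'} \<subseteq> set p" using n7 by auto
      with that(2) have "e \<subseteq> set p" by (rule order_trans)
      then have "e \<in> C" using no_chord that(1) by blast
      then obtain i where i: "i < n" "e = {p ! i, p ! (Suc i mod n)}"
        by (auto simp: cycle_edges_def n_def)
      then have iJ: "i \<in> ?J" "Suc i mod n \<in> ?J" using J[of i] J[of "Suc i mod n"] n7 by auto
      \<comment> \<open>The successor \<open>4\<close> is not an index of the configuration because \<open>4 < n - 2\<close>; this is where \<open>n \<ge> 7\<close> enters.\<close>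
      have "i \<noteq> 3"
      proof
        assume "i = 3"
        then have "Suc i mod n = 4" using n7 by simp
        then show False using iJ(2) n7 by auto
      qed
      then consider "i = 0" | "i = 1" | "i = n - 1" | "i = n - 2" | "i = 2" using iJ(1) by blast
      then show ?thesis
      proof cases
        case 3
        then have "Suc i = n" using n7 by simp
        then show ?thesis using i 3 by (simp add: insert_commute)
      next
        case 4
        then have "Suc i = n - 1" "n - 1 < n" using n7 by simp_all
        then show ?thesis using i 4 by (simp add: insert_commute)
      qed (use i n7 in \<open>simp_all add: eval_nat_numeral\<close>)
    qed
    show "g {?x, ?y} < g {?x, ?z}"
      by (rule least[OF wrap]) (use eq n7 in \<open>auto simp: doubleton_eq_iff\<close>)
    show "g {?x, ?y} < g {?y, ?w}"
      by (rule least[OF mem(2)]) (use eq n7 in \<open>auto simp: doubleton_eq_iff\<close>)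
    show "{?z, ?z'} = {?w, ?w'} \<or> {?z, ?z'} \<inter> {?w, ?w'} = {}" using eq n7 by auto
  qed (use eq n7 in auto)
  then show ?thesis by blast
qed

end

section \<open>Bridge-friendly unicyclic graphs\<close>

theorem theorem4p8:
  fixes E :: "'v::finite set set" and p :: "'v list"
  assumes "simple_graph E" and "connected_graph E" and "unicyclic E"
    and "is_cycle E p"
  shows "bridge_friendly (edge_ideal E :: ('v, 'k::field) polynomial set) \<longleftrightarrow>
    (length p = 3 \<or> length p = 5) \<and> (\<exists>v \<in> set p. degree E v = 2) \<or>
    length p = 6 \<and> (\<exists>u v. opposite p u v \<and> degree E u = 2 \<and> degree E v = 2)"
proof -
  interpret unicyclic_graph E p using assms by unfold_locales
  let ?n = "length p"
  have list3: "\<exists>a b c. q = [a, b, c]" if "length q = 3" for q :: "'v list"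
    using that by (auto simp: numeral_eq_Suc length_Suc_conv)
  have list4: "\<exists>a b c d. q = [a, b, c, d]" if "length q = 4" for q :: "'v list"
    using that by (auto simp: numeral_eq_Suc length_Suc_conv)
  have list5: "\<exists>a b c d e. q = [a, b, c, d, e]" if "length q = 5" for q :: "'v list"
    using that by (auto simp: numeral_eq_Suc length_Suc_conv)
  have list6: "\<exists>a b c d e f. q = [a, b, c, d, e, f]" if "length q = 6" for q :: "'v list"
    using that by (auto simp: numeral_eq_Suc length_Suc_conv)
  show ?thesis
    unfolding bridge_friendly_edge_ideal_iff[OF assms(1)]
  proof
    assume "\<exists>g. inj_on g E \<and> (\<forall>\<tau> a b. \<not> conflict E g \<tau> a b)"
    then obtain g where inj: "inj_on g E" and no: "\<And>\<tau> a b. \<not> conflict E g \<tau> a b" by blast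
    have "{p ! 0, p ! 1} \<in> C" using cycle_edges_at_head by blast
    then obtain c where c: "c \<in> C" "\<And>e. e \<in> C \<Longrightarrow> g c \<le> g e"
      using obtain_least_value[of "\<lambda>e. e \<in> C" _ g] by metis
    then obtain k where k: "k < ?n" "c = {p ! k, p ! (Suc k mod ?n)}"
      by (auto simp: cycle_edges_def)
    define q where "q = rotate k p"
    interpret Q: unicyclic_graph E q unfolding q_def by (rule rotate_locale)
    have len: "length q = ?n" by (simp add: q_def)
    have nth_q: "q ! i = p ! ((k + i) mod ?n)" if "i < ?n" for i
      using that by (simp add: q_def nth_rotate)
    have QC: "cycle_edges q = C" by (simp add: q_def cycle_edges_rotate)
    have c_q: "c = {q ! 0, q ! 1}" 
    proof -
      have "0 < ?n" "1 < ?n" using length_ge by linarith+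
      then show ?thesis using k nth_q[of 0] nth_q[of 1] by simp
    qed
    have least: "g {q ! 0, q ! 1} < g e" if "e \<in> cycle_edges q" "e \<noteq> {q ! 0, q ! 1}" for e
    proof -
      have "g c \<noteq> g e" 
        using inj_on_eq_iff[OF inj, of c e] c(1) that C_subset unfolding QC c_q by blast
      then show ?thesis using c(2)[of e] that(1) unfolding QC c_q by linarith
    qed
    consider "?n = 3" | "?n = 4" | "?n = 5" | "?n = 6" | "7 \<le> ?n" using length_ge by linarith
    then show "(?n = 3 \<or> ?n = 5) \<and> (\<exists>v \<in> set p. degree E v = 2) \<or>
      ?n = 6 \<and> (\<exists>u v. opposite p u v \<and> degree E u = 2 \<and> degree E v = 2)"
    proof cases
      case 1
      then obtain x y z where q: "q = [x, y, z]" using list3 len by metis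
      have "degree E z = 2" using Q.triangle_conflict[where g = g, OF q _ least] no by blast
      moreover have "z \<in> set p" using q unfolding q_def by (metis list.set_intros set_rotate)
      ultimately show ?thesis using 1 by blast
    next
      case 2
      then obtain x y w z where q: "q = [x, y, w, z]" using list4 len by metis
      show ?thesis using Q.square_conflict[where g = g, OF q least] no by blast
    next
      case 3
      then obtain x y w m z where q: "q = [x, y, w, m, z]" using list5 len by metis
      have "degree E w = 2 \<or> degree E z = 2"
        using Q.pentagon_conflict[where g = g, OF q _ _ least] no by blast
      moreover have "set q = set p" by (simp add: q_def)
      then have "w \<in> set p" "z \<in> set p" using q by auto
      ultimately show ?thesis using 3 by blast
    next
      case 4
      then obtain x y w w' z' z where q: "q = [x, y, w, w', z', z]" using list6 len by metis
      have "degree E w = 2 \<and> degree E z = 2"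
        using Q.hexagon_conflict[where g = g, OF q _ least] no by blast
      moreover have "opposite p w z"
        unfolding opposite_def
      proof (intro conjI exI[of _ "(k + 2) mod 6"])
        have "w = q ! 2" "z = q ! 5" by (simp_all add: q)
        moreover have "((k + 2) mod 6 + 3) mod 6 = (k + 5) mod 6" by presburger
        ultimately show "w = p ! ((k + 2) mod 6)" "z = p ! (((k + 2) mod 6 + 3) mod 6)"
          using nth_q[of 2] nth_q[of 5] 4 by simp_all
      qed (use 4 in simp_all)
      ultimately show ?thesis using 4 by blast
    next
      case 5
      then have "7 \<le> length q" using len by simp
      from Q.long_cycle_conflict[where g = g, OF this least] show ?thesis using no by blast
    qed
  next
    assume "(?n = 3 \<or> ?n = 5) \<and> (\<exists>v \<in> set p. degree E v = 2) \<or>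
      ?n = 6 \<and> (\<exists>u v. opposite p u v \<and> degree E u = 2 \<and> degree E v = 2)"
    then show "\<exists>g. inj_on g E \<and> (\<forall>\<tau> a b. \<not> conflict E g \<tau> a b)"
    proof (elim disjE conjE exE bexE)
      fix v assume v: "v \<in> set p" "degree E v = 2" and n: "?n = 3"
      obtain k where k: "k < ?n" "p ! k = v" using v by (metis in_set_conv_nth)
      interpret Q: unicyclic_graph E "rotate k p" by (rule rotate_locale)
      obtain a b c where q: "rotate k p = [a, b, c]" using list3[of "rotate k p"] n by auto
      have "rotate k p ! 0 = v" using k n by (simp add: nth_rotate)
      then show ?thesis using Q.triangle_friendly[OF q] v q by simp
    next
      fix v assume v: "v \<in> set p" "degree E v = 2" and n: "?n = 5"
      obtain k where k: "k < ?n" "p ! k = v" using v by (metis in_set_conv_nth)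
      interpret Q: unicyclic_graph E "rotate k p" by (rule rotate_locale)
      obtain a b c d e where q: "rotate k p = [a, b, c, d, e]" using list5[of "rotate k p"] n by auto
      have "rotate k p ! 0 = v" using k n by (simp add: nth_rotate)
      then show ?thesis using Q.pentagon_friendly[OF q] v q by simp
    next
      fix u v assume uv: "opposite p u v" "degree E u = 2" "degree E v = 2" and n: "?n = 6"
      obtain k where k: "k < 6" "u = p ! k" "v = p ! ((k + 3) mod 6)"
        using uv(1) unfolding opposite_def by blast
      interpret Q: unicyclic_graph E "rotate k p" by (rule rotate_locale)
      obtain a b c d e f where q: "rotate k p = [a, b, c, d, e, f]"
        using list6[of "rotate k p"] n by auto
      have "rotate k p ! 0 = u" "rotate k p ! 3 = v" using k n by (simp_all add: nth_rotate)
      then show ?thesis using Q.hexagon_friendly[OF q] uv q by simp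
    qed
  qed
qed

end
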